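(* Let $(W_t)_{t\ge 0}$ be a standard Wiener process, $M_t=\sup_{0\le s\le t}W_s$, $m_t=\inf_{0\le s\le t}W_s$, and for $t>0$ let $F_t(x,y,z)=\mathbb{P}(W_t\le x,\,M_t\le y,\,m_t\le z)$. Let $C_{W,M,m}:[0,1]^3\to[0,1]$ be the copula of the triple $(W_t,M_t,m_t)$ (which does not depend on $t>0$). Then for every $t>0$ and all $x,y,z\in\mathbb{R}$ $$F_t(x,y,z)=C_{W,M,m}\left(\Phi\left(\tfrac{x}{\sqrt t}\right),\left(2\Phi\left(\tfrac{y}{\sqrt t}\right)-1\right)^+,\min\left(2\Phi\left(\tfrac{z}{\sqrt t}\right),1\right)\right),$$ and for all $u,v,w\in(0,1)$ $$C_{W,M,m}(u,v,w)=\begin{cases} u-\Phi\big(\Phi^{-1}(u)-r\big) & \text{if } 2u\le w,\\[2pt] 2\Psi\big(\Phi^{-1}(w/2),r,s\big)-\Psi\big(\Phi^{-1}(u)-s,r,s\big)-\Psi\big(-\Phi^{-1}(u)-s+r,r,s\big) & \text{if } w<2u\le 1+v,\\[2pt] 2\Psi\big(\Phi^{-1}(w/2),r,s\big)-2\Psi\big(2\Phi^{-1}(w/2)-\Phi^{-1}((1+v)/2),r,s\big) & \text{if } 1+v<2u,\end{cases}$$ where $$\Psi(q,r,s)=\sum_{k=0}^\infty\big(\Phi(q-ks)-\Phi(q-r-ks)\big),\qquad r=2\Phi^{-1}\big((1+v)/2\big),\qquad s=2\big(\Phi^{-1}((1+v)/2)-\Phi^{-1}(w/2)\big).$$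
   Context: $\Phi$ denotes the cumulative distribution function of the standard normal law $N(0,1)$, $\Phi^{-1}$ its inverse, and $a^+=\max(a,0)$. The Wiener process starts at $W_0=0$. A copula is the restriction to $[0,1]^3$ of a distribution function whose univariate margins are uniform on $[0,1]$. By Sklar's theorem, for a random vector $(X_1,X_2,X_3)$ with continuous marginal distribution functions $F_1,F_2,F_3$ there is a unique copula $C$ (called the copula of the vector) with $\mathbb{P}(X_1\le x_1,X_2\le x_2,X_3\le x_3)=C(F_1(x_1),F_2(x_2),F_3(x_3))$ for all real $x_1,x_2,x_3$. The process $(W_t,M_t,m_t)$ is self-similar, $(W_t,M_t,m_t)\stackrel{d}{=}(\sqrt t\,W_1,\sqrt t\,M_1,\sqrt t\,m_1)$, so its copula does not depend on $t>0$. *)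

theory Defs
  imports "HOL-Probability.Probability"
begin

definition Phi :: "real \<Rightarrow> real" ("\<Phi>")
  where "\<Phi> = cdf std_normal_distribution"

text \<open>\<^const>\<open>Phi\<close> is a bijection from the reals onto the open interval from 0 to 1, so its
  Hilbert-choice inverse is the genuine inverse there; outside that interval it is unspecified.\<close>

abbreviation Phi_inv :: "real \<Rightarrow> real" ("\<Phi>\<^sup>-\<^sup>1")
  where "\<Phi>\<^sup>-\<^sup>1 \<equiv> inv \<Phi>"

definition Psi :: "real \<Rightarrow> real \<Rightarrow> real \<Rightarrow> real" ("\<Psi>")
  where "\<Psi> q r s = (\<Sum>k. \<Phi> (q - real k * s) - \<Phi> (q - r - real k * s))"

text \<open>The paths of a Wiener process are indexed by all reals, but only the times \<open>t \<ge> 0\<close> are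
  constrained. Every path, not just almost every one, is continuous; this makes the running
  maximum and minimum below finite and measurable without completing the underlying space.\<close>

locale wiener_process = prob_space P for P :: "'a measure" +
  fixes W :: "real \<Rightarrow> 'a \<Rightarrow> real"
  assumes measurable_W: "0 \<le> t \<Longrightarrow> W t \<in> borel_measurable P"
    and start_zero: "\<omega> \<in> space P \<Longrightarrow> W 0 \<omega> = 0"
    and continuous_paths: "\<omega> \<in> space P \<Longrightarrow> continuous_on {0..} (\<lambda>t. W t \<omega>)"
    and independent_increments:
      "0 \<le> \<tau> 0 \<Longrightarrow> (\<And>i. i < n \<Longrightarrow> \<tau> i < \<tau> (Suc i)) \<Longrightarrow>
        indep_vars (\<lambda>_. borel) (\<lambda>i \<omega>. W (\<tau> (Suc i)) \<omega> - W (\<tau> i) \<omega>) {..<n::nat}"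
    and normal_increments:
      "0 \<le> s \<Longrightarrow> s < t \<Longrightarrow>
        distributed P lborel (\<lambda>\<omega>. W t \<omega> - W s \<omega>) (normal_density 0 (sqrt (t - s)))"

definition running_max :: "(real \<Rightarrow> 'a \<Rightarrow> real) \<Rightarrow> real \<Rightarrow> 'a \<Rightarrow> real"
  where "running_max W t \<omega> = (SUP s\<in>{0..t}. W s \<omega>)"

definition running_min :: "(real \<Rightarrow> 'a \<Rightarrow> real) \<Rightarrow> real \<Rightarrow> 'a \<Rightarrow> real"
  where "running_min W t \<omega> = (INF s\<in>{0..t}. W s \<omega>)"

definition joint_cdf3 ::
    "'a measure \<Rightarrow> ('a \<Rightarrow> real) \<Rightarrow> ('a \<Rightarrow> real) \<Rightarrow> ('a \<Rightarrow> real) \<Rightarrow> real \<Rightarrow> real \<Rightarrow> real \<Rightarrow> real"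
  where "joint_cdf3 P X Y Z x y z = \<P>(\<omega> in P. X \<omega> \<le> x \<and> Y \<omega> \<le> y \<and> Z \<omega> \<le> z)"

text \<open>Copulas are functions on the closed unit cube. They are represented by functions on the whole
  type that are \<^const>\<open>undefined\<close> off the cube, so that equality of functions is equality of copulas.\<close>

abbreviation unit_cube :: "(real \<times> real \<times> real) set"
  where "unit_cube \<equiv> {0..1} \<times> {0..1} \<times> {0..1}"

definition copula :: "(real \<times> real \<times> real \<Rightarrow> real) \<Rightarrow> bool"
  where "copula C \<longleftrightarrow>
    C \<in> extensional unit_cube \<and>
    (\<exists>\<mu> :: (real \<times> real \<times> real) measure.
      prob_space \<mu> \<and> sets \<mu> = sets borel \<and>
      distr \<mu> borel (\<lambda>(a, b, c). a) = uniform_measure lborel {0..1} \<and>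
      distr \<mu> borel (\<lambda>(a, b, c). b) = uniform_measure lborel {0..1} \<and>
      distr \<mu> borel (\<lambda>(a, b, c). c) = uniform_measure lborel {0..1} \<and>
      (\<forall>(u, v, w) \<in> unit_cube. C (u, v, w) = measure \<mu> ({..u} \<times> {..v} \<times> {..w})))"

definition is_copula_of ::
    "'a measure \<Rightarrow> ('a \<Rightarrow> real) \<Rightarrow> ('a \<Rightarrow> real) \<Rightarrow> ('a \<Rightarrow> real) \<Rightarrow> (real \<times> real \<times> real \<Rightarrow> real) \<Rightarrow> bool"
  where "is_copula_of P X Y Z C \<longleftrightarrow>
    copula C \<and>
    (\<forall>x y z. joint_cdf3 P X Y Z x y z =
      C (cdf (distr P borel X) x, cdf (distr P borel Y) y, cdf (distr P borel Z) z))"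

end

theory Submission
  imports Defs
begin

text \<open>
  Reflecting only the part of the path after its first visit to a barrier shows that a bounded
  Lipschitz function \<open>g\<close> which is odd about every point of a closed set \<open>B\<close> satisfies
  \<open>E[g(W\<^sub>T); W hits B before T] = 0\<close>. On a finite grid this follows from the symmetry and independence of
  the increments, with an error proportional to the tolerance used to detect a visit; dyadic grids
  and continuity of the paths remove the error. Consequently \<open>P(W\<^sub>T \<in> S, W hits B) = P(W\<^sub>T \<in> S', W hits B)\<close>
  whenever \<open>S'\<close> is the mirror image of \<open>S\<close> in every point of \<open>B\<close>. A half-line and one barrier give the
  marginal laws; for the barriers \<open>z < 0 < y\<close> one takes for \<open>S\<close> the union of all translates of
  \<open>[z, x]\<close> by multiples of \<open>2(y - z)\<close>. A path that stays between the barriers ends in \<open>S\<close> exactly if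
  it ends below \<open>x\<close> and never ends in \<open>S'\<close>, so the probability of staying inside with \<open>W\<^sub>T \<le> x\<close> is
  \<open>P(W\<^sub>T \<in> S) - P(W\<^sub>T \<in> S')\<close>, which is a combination of the series \<open>\<Psi>\<close>.
\<close>

subsection \<open>The standard normal distribution function\<close>

text \<open>The hypotheses speak only of increments between fixed times, while the reflection takes
  place at a random one, and a finite grid usually sees no exact visit to a barrier. This dictates
  the order: Lipschitz functions first, because for them a near visit costs only a small error, and
  indicators after the grid has been refined. Hitting an upper barrier means
  \<open>y \<le> M\<close>, so the computed events involve \<open>M < y\<close>; continuity of the
  law of the maximum then gives \<open>M \<le> y\<close>. The maximum has no mass below 0, so the
  margins have flat pieces and are not invertible on the line; Sklar's theorem has to cope with
  that. The translates run over all integers but \<Psi> only over the natural numbers: the symmetry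
  of the normal law moves the translates in the upper tail to the lower one. The third case of the
  formula is the second with \<open>x\<close> replaced by \<open>y\<close>, because
  \<open>W \<le> M\<close>.\<close>

interpretation std_normal: real_distribution std_normal_distribution
  by (rule real_dist_normal_dist)

lemma AE_std_normal_neq: "AE x in std_normal_distribution. x \<noteq> a"
  using AE_lborel_singleton[of a] by (auto simp: AE_density)

lemma isCont_Phi: "isCont \<Phi> x"
proof -
  have "measure std_normal_distribution {x} = measure std_normal_distribution {}"
    by (rule measure_eq_AE) (use AE_std_normal_neq[of x] in auto)
  then show ?thesis
    unfolding Phi_def std_normal.isCont_cdf by simp
qed

text \<open>The density vanishes nowhere, so an interval of normal mass 0 would be a Lebesgue null
  set.\<close>

lemma strict_mono_Phi: "strict_mono \<Phi>"
proof (rule strict_monoI)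
  fix a b :: real assume "a < b"
  have "measure std_normal_distribution {a<..b} \<noteq> 0"
  proof
    assume "measure std_normal_distribution {a<..b} = 0"
    then have "{a<..b} \<in> null_sets std_normal_distribution"
      by (simp add: null_setsI std_normal.emeasure_eq_measure)
    then have "AE x in lborel. x \<notin> {a<..b}"
      by (auto simp: null_sets_density_iff normal_density_def)
    then have "{a<..b} \<in> null_sets lborel"
      by (subst (asm) AE_iff_null_sets[symmetric]) auto
    with \<open>a < b\<close> show False
      by (simp add: null_sets_def)
  qed
  then have "0 < measure std_normal_distribution {a<..b}"
    by (simp add: zero_less_measure_iff)
  then show "\<Phi> a < \<Phi> b"
    using std_normal.cdf_diff_eq[OF \<open>a < b\<close>] by (simp add: Phi_def)
qed

lemmas Phi_less_iff = strict_mono_less[OF strict_mono_Phi]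
  and Phi_le_iff = strict_mono_less_eq[OF strict_mono_Phi]

lemma distr_std_normal_uminus:
  "distr std_normal_distribution borel uminus = std_normal_distribution"
proof -
  have "distributed std_normal_distribution lborel (\<lambda>x. x) std_normal_density"
    by (auto simp: distributed_def distr_id2)
  from std_normal.normal_density_affine[OF this, of "-1" 0]
  have "distributed std_normal_distribution lborel uminus std_normal_density"
    by simp
  then show ?thesis
    by (simp add: distributed_def cong: distr_cong)
qed

lemma measure_std_normal_Icc: "a \<le> b \<Longrightarrow> measure std_normal_distribution {a..b} = \<Phi> b - \<Phi> a"
proof -
  assume "a \<le> b"
  have "measure std_normal_distribution {a..b} = measure std_normal_distribution {a<..b}"
    by (rule measure_eq_AE) (use AE_std_normal_neq[of a] in auto)
  also have "\<dots> = \<Phi> b - \<Phi> a"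
    using std_normal.cdf_diff_eq[of a b] \<open>a \<le> b\<close> by (cases "a = b") (auto simp: Phi_def)
  finally show ?thesis .
qed

lemma measure_std_normal_atLeast: "measure std_normal_distribution {a..} = 1 - \<Phi> a"
proof -
  have "measure std_normal_distribution {a..} = measure std_normal_distribution (UNIV - {..a})"
    by (rule measure_eq_AE) (use AE_std_normal_neq[of a] in auto)
  also have "\<dots> = 1 - \<Phi> a"
    using std_normal.prob_compl[of "{..a}"] by (simp add: Phi_def cdf_def)
  finally show ?thesis .
qed

lemma Phi_minus: "\<Phi> (- x) = 1 - \<Phi> x"
proof -
  have "\<Phi> (- x) = measure (distr std_normal_distribution borel uminus) {..- x}"
    by (simp add: distr_std_normal_uminus Phi_def cdf_def)
  also have "\<dots> = measure std_normal_distribution {x..}"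
    by (subst measure_distr) (auto intro!: arg_cong[where f="measure _"])
  finally show ?thesis
    by (simp add: measure_std_normal_atLeast)
qed

lemma Phi_0: "\<Phi> 0 = 1 / 2"
  using Phi_minus[of 0] by simp

lemma (in real_distribution) cdf_surj:
  assumes cont: "\<And>x. isCont (cdf M) x" and "0 < u" "u < 1"
  shows "\<exists>x. cdf M x = u"
proof -
  have "eventually (\<lambda>x. cdf M x < u) at_bot" "eventually (\<lambda>x. u < cdf M x) at_top"
    using order_tendstoD(2)[OF cdf_lim_at_bot] order_tendstoD(1)[OF cdf_lim_at_top_prob] assms(2,3)
    by auto
  then obtain a b where ab: "\<And>x. x \<le> a \<Longrightarrow> cdf M x < u" "\<And>x. b \<le> x \<Longrightarrow> u < cdf M x"
    unfolding eventually_at_bot_linorder eventually_at_top_linorder by auto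
  then have "cdf M a < u" "u < cdf M b" by auto
  moreover from this have "a \<le> b"
    using cdf_nondecreasing[of b a] by linarith
  ultimately show ?thesis
    using IVT'[of "cdf M" a u b] cont by (force intro: continuous_at_imp_continuous_on)
qed

lemma Phi_Phi_inv: "0 < u \<Longrightarrow> u < 1 \<Longrightarrow> \<Phi> (\<Phi>\<^sup>-\<^sup>1 u) = u"
  using std_normal.cdf_surj[of u] isCont_Phi f_inv_into_f[of u \<Phi> UNIV]
  by (auto simp: Phi_def)

subsection \<open>Sklar's theorem for continuous margins\<close>

text \<open>A continuous distribution function may be flat, so its level set at height
  \<open>u\<close> need not be a point. For \<open>0 < u < 1\<close> the right end \<open>m\<close>
  of that level set shows that the sublevel set is the half-line \<open>{..m}\<close>, which has
  mass \<open>u\<close>.\<close>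

lemma (in real_distribution) measure_cdf_le:
  assumes cont: "\<And>x. isCont (cdf M) x" and "0 \<le> u" "u \<le> 1"
  shows "measure M {x. cdf M x \<le> u} = u"
proof -
  have [measurable]: "cdf M \<in> borel_measurable borel"
    using cont by (intro borel_measurable_continuous_onI continuous_at_imp_continuous_on) auto
  have meas: "{x. cdf M x \<le> u} \<in> sets M" for u
    by simp
  have *: "measure M {x. cdf M x \<le> u} = u" if u: "0 < u" "u < 1" for u
  proof -
    let ?K = "{x. cdf M x = u}"
    have "?K \<noteq> {}"
      using cdf_surj[OF cont u] by auto
    have "eventually (\<lambda>x. u < cdf M x) at_top"
      using order_tendstoD(1)[OF cdf_lim_at_top_prob] u by auto
    then obtain b where b: "\<And>x. b \<le> x \<Longrightarrow> u < cdf M x"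
      unfolding eventually_at_top_linorder by auto
    have "bdd_above ?K"
    proof (rule bdd_aboveI)
      fix x assume "x \<in> ?K"
      with b[of x] show "x \<le> b" by (cases "b \<le> x") auto
    qed
    have "closed ?K"
      using cont by (intro closed_Collect_eq continuous_at_imp_continuous_on) auto
    define m where "m = Sup ?K"
    have "m \<in> ?K"
      unfolding m_def by (rule closed_contains_Sup) fact+
    then have K: "cdf M m = u"
      by simp
    have m: "x \<le> m" if "cdf M x = u" for x
      unfolding m_def using \<open>bdd_above ?K\<close> that by (intro cSup_upper) simp_all
    have "cdf M x \<le> u \<longleftrightarrow> x \<le> m" for x
      using cdf_nondecreasing[of m x] cdf_nondecreasing[of x m] m[of x] K by linarith
    then have "{x. cdf M x \<le> u} = {..m}"
      by auto
    with K show ?thesis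
      by (simp add: cdf_def)
  qed
  consider "u = 0" | "u = 1" | "0 < u" "u < 1"
    using assms by linarith
  then show ?thesis
  proof cases
    case 1
    \<comment> \<open>The level set at height 0 may be empty. Small positive levels are used
      instead; the minimum with \<open>1/2\<close> keeps them below 1.\<close>
    have "measure M {x. cdf M x \<le> 0} \<le> e" if "0 < e" for e
    proof -
      have "measure M {x. cdf M x \<le> 0} \<le> measure M {x. cdf M x \<le> min e (1/2)}"
        using that by (intro finite_measure_mono meas Collect_mono impI) simp
      also have "\<dots> = min e (1/2)"
        using that by (intro *) simp_all
      finally show ?thesis by simp
    qed
    then have "measure M {x. cdf M x \<le> 0} \<le> 0"
      by (rule field_le_epsilon) simp
    with 1 show ?thesis by (simp add: measure_le_0_iff)
  next
    case 2
    then have "{x. cdf M x \<le> u} = UNIV"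
      using cdf_bounded_prob by auto
    with 2 show ?thesis
      using prob_space by simp
  qed (rule *)
qed

lemma measure_uniform_unit_atMost:
  "measure (uniform_measure lborel {0..1::real}) {..u} = max 0 (min 1 u)"
proof -
  have "{0..1} \<inter> {..u} = {0..min 1 u}" by auto
  then show ?thesis
    by (simp add: measure_uniform_measure)
qed

lemma real_distribution_uniform_unit: "real_distribution (uniform_measure lborel {0..1::real})"
  by (simp add: real_distribution_def real_distribution_axioms_def prob_space_uniform_measure)

lemma (in real_distribution) distr_cdf_uniform:
  assumes cont: "\<And>x. isCont (cdf M) x"
  shows "distr M borel (cdf M) = uniform_measure lborel {0..1}"
proof (rule cdf_unique)
  have [measurable]: "cdf M \<in> borel_measurable borel"
    using cont by (intro borel_measurable_continuous_onI continuous_at_imp_continuous_on) auto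
  show "real_distribution (distr M borel (cdf M))"
    by (rule real_distribution_distr) simp
  show "real_distribution (uniform_measure lborel {0..1::real})"
    by (rule real_distribution_uniform_unit)
  show "cdf (distr M borel (cdf M)) = cdf (uniform_measure lborel {0..1})"
  proof
    fix u
    have "cdf (distr M borel (cdf M)) u = measure M {x. cdf M x \<le> u}"
        by (subst cdf_def, subst measure_distr) (auto intro!: arg_cong[where f="measure M"])
    also have "\<dots> = max 0 (min 1 u)"
    proof -
      consider "u < 0" | "1 < u" | "0 \<le> u" "u \<le> 1" by linarith
      then show ?thesis
      proof cases
        case 1
        then have "{x. cdf M x \<le> u} = {}"
          using cdf_nonneg by (force simp: not_le intro: less_le_trans)
        with 1 show ?thesis by simp
      next
        case 2
        then have "{x. cdf M x \<le> u} = UNIV"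
          using cdf_bounded_prob by (auto intro: order_trans less_imp_le)
        with 2 prob_space show ?thesis by simp
      next
        case 3
        then show ?thesis using measure_cdf_le[OF cont, of u] by simp
      qed
    qed
    finally show "cdf (distr M borel (cdf M)) u = cdf (uniform_measure lborel {0..1}) u"
      by (simp add: cdf_def measure_uniform_unit_atMost)
  qed
qed

text \<open>Only points on a flat piece to the right of \<open>x\<close> violate the equivalence,
  and they carry no mass. This makes the copula identity hold at every real argument although the
  margins need not be injective.\<close>

lemma (in real_distribution) AE_cdf_le_iff:
  assumes cont: "\<And>x. isCont (cdf M) x"
  shows "AE s in M. cdf M s \<le> cdf M x \<longleftrightarrow> s \<le> x"
proof -
  have [measurable]: "cdf M \<in> borel_measurable borel"
    using cont by (intro borel_measurable_continuous_onI continuous_at_imp_continuous_on) auto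
  have "prob ({s. cdf M s \<le> cdf M x} - {..x}) = prob {s. cdf M s \<le> cdf M x} - prob {..x}"
    by (rule finite_measure_Diff) (auto intro: cdf_nondecreasing)
  also have "\<dots> = 0"
    using measure_cdf_le[OF cont cdf_nonneg cdf_bounded_prob, of x] by (simp add: cdf_def)
  finally have "AE s in M. s \<notin> {s. cdf M s \<le> cdf M x} - {..x}"
    by (subst (asm) prob_eq_0) auto
  then show ?thesis
    by eventually_elim (auto intro: cdf_nondecreasing)
qed

lemma sets_borel_lower_orthant:
  "{..u} \<times> {..v} \<times> {..w} \<in> sets (borel :: (real \<times> real \<times> real) measure)"
  by (intro borel_closed closed_Times) auto

text \<open>One orthant is covered by the other together with three slabs, and uniform margins bound
  the mass of each slab by its width. Exchanging the two points gives Lipschitz continuity.\<close>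

lemma copula_le_add:
  assumes "copula C" and uvw: "(u, v, w) \<in> unit_cube" and uvw': "(u', v', w') \<in> unit_cube"
  shows "C (u, v, w) \<le> C (u', v', w') + \<bar>u - u'\<bar> + \<bar>v - v'\<bar> + \<bar>w - w'\<bar>"
proof -
  obtain \<mu> :: "(real \<times> real \<times> real) measure" where "prob_space \<mu>" and sets: "sets \<mu> = sets borel"
    and margins: "distr \<mu> borel (\<lambda>(a, b, c). a) = uniform_measure lborel {0..1}"
      "distr \<mu> borel (\<lambda>(a, b, c). b) = uniform_measure lborel {0..1}"
      "distr \<mu> borel (\<lambda>(a, b, c). c) = uniform_measure lborel {0..1}"
    and C: "\<And>u v w. (u, v, w) \<in> unit_cube \<Longrightarrow> C (u, v, w) = measure \<mu> ({..u} \<times> {..v} \<times> {..w})"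
    using \<open>copula C\<close> unfolding copula_def by blast
  interpret prob_space \<mu> by fact
  have meas: "f \<in> borel_measurable \<mu> \<longleftrightarrow> f \<in> borel_measurable (borel \<Otimes>\<^sub>M borel \<Otimes>\<^sub>M borel)"
    for f :: "real \<times> real \<times> real \<Rightarrow> real"
    by (simp add: measurable_cong_sets[OF sets refl] borel_prod)
  have slab: "{p. f p \<in> {a'<..a}} \<in> sets \<mu> \<and> prob {p. f p \<in> {a'<..a}} \<le> \<bar>a - a'\<bar>"
    if "distr \<mu> borel f = uniform_measure lborel {0..1}" "f \<in> borel_measurable \<mu>"
      "a \<in> {0..1}" "a' \<in> {0..1}" for f a a'
  proof
    have eq: "{p. f p \<in> {a'<..a}} = f -` {a'<..a} \<inter> space \<mu>"
      using sets_eq_imp_space_eq[OF sets] by auto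
    show "{p. f p \<in> {a'<..a}} \<in> sets \<mu>"
      unfolding eq using that(2) by (rule measurable_sets) simp
    have "prob {p. f p \<in> {a'<..a}} = measure (distr \<mu> borel f) {a'<..a}"
      unfolding eq using that(2) by (simp add: measure_distr)
    also have "\<dots> = measure lborel ({0..1} \<inter> {a'<..a})"
      unfolding that(1) by simp
    also have "{0..1} \<inter> {a'<..a} = {a'<..a}"
      using that(3,4) by auto
    also have "measure lborel {a'<..a} \<le> \<bar>a - a'\<bar>"
      by (cases "a' \<le> a") auto
    finally show "prob {p. f p \<in> {a'<..a}} \<le> \<bar>a - a'\<bar>" .
  qed
  let ?U = "{p. (\<lambda>(a, b, c). a) p \<in> {u'<..u}}"
  let ?V = "{p. (\<lambda>(a, b, c). b) p \<in> {v'<..v}}"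
  let ?W = "{p. (\<lambda>(a, b, c). c) p \<in> {w'<..w}}"
  have U: "?U \<in> sets \<mu> \<and> prob ?U \<le> \<bar>u - u'\<bar>"
    using uvw uvw' by (intro slab margins) (auto simp: meas)
  have V: "?V \<in> sets \<mu> \<and> prob ?V \<le> \<bar>v - v'\<bar>"
    using uvw uvw' by (intro slab margins) (auto simp: meas)
  have W: "?W \<in> sets \<mu> \<and> prob ?W \<le> \<bar>w - w'\<bar>"
    using uvw uvw' by (intro slab margins) (auto simp: meas)
  let ?B = "{..u'} \<times> {..v'} \<times> {..w'}"
  have B: "?B \<in> sets \<mu>"
    unfolding sets by (rule sets_borel_lower_orthant)
  have "C (u, v, w) \<le> prob (((?B \<union> ?U) \<union> ?V) \<union> ?W)"
    unfolding C[OF uvw] using B U V W by (intro finite_measure_mono) auto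
  also have "\<dots> \<le> prob ?B + prob ?U + prob ?V + prob ?W"
    using B U V W measure_Un_le[of ?B \<mu> ?U] measure_Un_le[of "?B \<union> ?U" \<mu> ?V]
      measure_Un_le[of "?B \<union> ?U \<union> ?V" \<mu> ?W] by auto
  finally show ?thesis
    using U V W C[OF uvw'] by linarith
qed

lemma copula_eqI:
  assumes "copula C" "copula C'"
    and eq: "\<And>u v w. u \<in> {0<..<1} \<Longrightarrow> v \<in> {0<..<1} \<Longrightarrow> w \<in> {0<..<1} \<Longrightarrow> C (u, v, w) = C' (u, v, w)"
  shows "C = C'"
proof (rule extensionalityI)
  show "C \<in> extensional unit_cube" "C' \<in> extensional unit_cube"
    using assms(1,2) by (simp_all add: copula_def)
  fix p :: "real \<times> real \<times> real" assume "p \<in> unit_cube"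
  then obtain u v w where p: "p = (u, v, w)" and cube: "(u, v, w) \<in> unit_cube"
    by (cases p) auto
  have le: "\<bar>C (u, v, w) - C' (u, v, w)\<bar> \<le> 6 * e" if e: "0 < e" "e < 1" for e
  proof -
    \<comment> \<open>Contraction towards the centre of the cube, which lands in the open cube. The
      constant 6 counts three coordinates for each of the two copulas.\<close>
    define T where "T a = (1 - e) * a + e / 2" for a
    have T: "T a \<in> {0<..<1} \<and> \<bar>a - T a\<bar> \<le> e \<and> \<bar>T a - a\<bar> \<le> e" if "0 \<le> a" "a \<le> 1" for a
    proof -
      have "0 \<le> (1 - e) * a" "(1 - e) * a \<le> 1 - e" "0 \<le> e * a" "e * a \<le> e"
        using that e by (auto simp: mult_left_le)
      moreover have "a - T a = e * a - e / 2"
        by (simp add: T_def algebra_simps)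
      ultimately show ?thesis
        using e unfolding T_def greaterThanLessThan_iff by linarith
    qed
    have "0 \<le> u" "u \<le> 1" "0 \<le> v" "v \<le> 1" "0 \<le> w" "w \<le> 1"
      using cube by auto
    note Ts = T[OF this(1,2)] T[OF this(3,4)] T[OF this(5,6)]
    then have cube': "(T u, T v, T w) \<in> unit_cube"
      by auto
    have "C (T u, T v, T w) = C' (T u, T v, T w)"
      using Ts by (intro eq) auto
    then show ?thesis
      using copula_le_add[OF assms(1) cube cube'] copula_le_add[OF assms(1) cube' cube]
        copula_le_add[OF assms(2) cube cube'] copula_le_add[OF assms(2) cube' cube] Ts
      by linarith
  qed
  have "\<bar>C (u, v, w) - C' (u, v, w)\<bar> \<le> 0"
  proof (rule field_le_epsilon)
    fix e :: real assume "0 < e"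
    then show "\<bar>C (u, v, w) - C' (u, v, w)\<bar> \<le> 0 + e"
      using le[of "e / 6"] le[of "1 / 2"] by (cases "e \<le> 3") simp_all
  qed
  then show "C p = C' p"
    by (simp add: p)
qed

text \<open>Existence: the law of the vector transformed by its own marginal distribution functions
  has uniform margins. Uniqueness: every point of the open cube is of the form
  \<open>(?F x, ?G y, ?H z)\<close>, so the joint distribution function fixes the copula there, and
  continuity does the rest.\<close>

theorem (in prob_space) sklar_continuous_margins:
  fixes X Y Z :: "'a \<Rightarrow> real"
  assumes X[measurable]: "X \<in> borel_measurable M" and Y[measurable]: "Y \<in> borel_measurable M"
    and Z[measurable]: "Z \<in> borel_measurable M"
    and contX: "\<And>x. isCont (cdf (distr M borel X)) x"
    and contY: "\<And>x. isCont (cdf (distr M borel Y)) x"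
    and contZ: "\<And>x. isCont (cdf (distr M borel Z)) x"
  shows "\<exists>!C. is_copula_of M X Y Z C"
proof (rule ex_ex1I)
  let ?F = "cdf (distr M borel X)" and ?G = "cdf (distr M borel Y)" and ?H = "cdf (distr M borel Z)"
  interpret DX: real_distribution "distr M borel X" by simp
  interpret DY: real_distribution "distr M borel Y" by simp
  interpret DZ: real_distribution "distr M borel Z" by simp
  have [measurable]: "?F \<in> borel_measurable borel" "?G \<in> borel_measurable borel" "?H \<in> borel_measurable borel"
    using contX contY contZ
    by (auto intro!: borel_measurable_continuous_onI continuous_at_imp_continuous_on)
  define T where "T \<omega> = (?F (X \<omega>), ?G (Y \<omega>), ?H (Z \<omega>))" for \<omega>
  have T[measurable]: "T \<in> measurable M borel"
    unfolding T_def by simp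
  define C where "C = restrict (\<lambda>(u, v, w). measure (distr M borel T) ({..u} \<times> {..v} \<times> {..w})) unit_cube"
  have margin: "distr M borel (\<lambda>\<omega>. cdf (distr M borel V) (V \<omega>)) = uniform_measure lborel {0..1}"
    if [measurable]: "V \<in> borel_measurable M" and cont: "\<And>x. isCont (cdf (distr M borel V)) x" for V
  proof -
    interpret DV: real_distribution "distr M borel V" by simp
    have [measurable]: "cdf (distr M borel V) \<in> borel_measurable borel"
      using cont by (intro borel_measurable_continuous_onI continuous_at_imp_continuous_on) auto
    show ?thesis
      using DV.distr_cdf_uniform[OF cont] by (subst (asm) distr_distr) (simp_all add: comp_def)
  qed
  have [measurable]: "(\<lambda>(a, b, c). a) \<in> borel_measurable (borel :: (real \<times> real \<times> real) measure)"
      "(\<lambda>(a, b, c). b) \<in> borel_measurable (borel :: (real \<times> real \<times> real) measure)"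
      "(\<lambda>(a, b, c). c) \<in> borel_measurable (borel :: (real \<times> real \<times> real) measure)"
    unfolding borel_prod[symmetric] by measurable
  have "copula C"
    unfolding copula_def
  proof (intro conjI exI[of _ "distr M borel T"])
    show "distr (distr M borel T) borel (\<lambda>(a, b, c). a) = uniform_measure lborel {0..1}"
      using margin[OF X contX] by (subst distr_distr) (simp_all add: comp_def T_def)
    show "distr (distr M borel T) borel (\<lambda>(a, b, c). b) = uniform_measure lborel {0..1}"
      using margin[OF Y contY] by (subst distr_distr) (simp_all add: comp_def T_def)
    show "distr (distr M borel T) borel (\<lambda>(a, b, c). c) = uniform_measure lborel {0..1}"
      using margin[OF Z contZ] by (subst distr_distr) (simp_all add: comp_def T_def)
  qed (auto simp: C_def intro: prob_space_distr)
  moreover have "joint_cdf3 M X Y Z x y z = C (?F x, ?G y, ?H z)" for x y z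
  proof -
    have "(?F x, ?G y, ?H z) \<in> unit_cube"
      by (auto simp: DX.cdf_nonneg DY.cdf_nonneg DZ.cdf_nonneg DX.cdf_bounded_prob DY.cdf_bounded_prob
          DZ.cdf_bounded_prob)
    then have "C (?F x, ?G y, ?H z) = measure (distr M borel T) ({..?F x} \<times> {..?G y} \<times> {..?H z})"
      by (simp add: C_def)
    also have "\<dots> = measure M {\<omega> \<in> space M. ?F (X \<omega>) \<le> ?F x \<and> ?G (Y \<omega>) \<le> ?G y \<and> ?H (Z \<omega>) \<le> ?H z}"
      by (subst measure_distr[OF T sets_borel_lower_orthant]) (auto simp: T_def intro!: arg_cong[where f="measure M"])
    also have "\<dots> = measure M {\<omega> \<in> space M. X \<omega> \<le> x \<and> Y \<omega> \<le> y \<and> Z \<omega> \<le> z}"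
    proof (rule measure_eq_AE)
      have "AE \<omega> in M. ?F (X \<omega>) \<le> ?F x \<longleftrightarrow> X \<omega> \<le> x"
        using DX.AE_cdf_le_iff[OF contX] by (subst (asm) AE_distr_iff) auto
      moreover have "AE \<omega> in M. ?G (Y \<omega>) \<le> ?G y \<longleftrightarrow> Y \<omega> \<le> y"
        using DY.AE_cdf_le_iff[OF contY] by (subst (asm) AE_distr_iff) auto
      moreover have "AE \<omega> in M. ?H (Z \<omega>) \<le> ?H z \<longleftrightarrow> Z \<omega> \<le> z"
        using DZ.AE_cdf_le_iff[OF contZ] by (subst (asm) AE_distr_iff) auto
      ultimately show "AE \<omega> in M. \<omega> \<in> {\<omega> \<in> space M. ?F (X \<omega>) \<le> ?F x \<and> ?G (Y \<omega>) \<le> ?G y \<and> ?H (Z \<omega>) \<le> ?H z}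
          \<longleftrightarrow> \<omega> \<in> {\<omega> \<in> space M. X \<omega> \<le> x \<and> Y \<omega> \<le> y \<and> Z \<omega> \<le> z}"
        by eventually_elim auto
    qed simp_all
    finally show ?thesis
      by (simp add: joint_cdf3_def)
  qed
  ultimately show "\<exists>C. is_copula_of M X Y Z C"
    unfolding is_copula_of_def by blast
  fix C C' assume "is_copula_of M X Y Z C" "is_copula_of M X Y Z C'"
  then have C: "copula C" "copula C'" and eq: "\<And>x y z. C (?F x, ?G y, ?H z) = C' (?F x, ?G y, ?H z)"
    unfolding is_copula_of_def by metis+
  show "C = C'"
  proof (rule copula_eqI[OF C])
    fix u v w :: real assume "u \<in> {0<..<1}" "v \<in> {0<..<1}" "w \<in> {0<..<1}"
    then obtain x y z where "?F x = u" "?G y = v" "?H z = w"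
      using DX.cdf_surj[OF contX, of u] DY.cdf_surj[OF contY, of v] DZ.cdf_surj[OF contZ, of w] by auto
    then show "C (u, v, w) = C' (u, v, w)"
      using eq[of x y z] by simp
  qed
qed

subsection \<open>The reflection principle\<close>

text \<open>By independence the joint law is a product, and flipping the sign of
  \<open>f (Z \<omega>)\<close> leaves that factor unchanged. Later \<open>Y\<close> is the past of
  the path and \<open>f (Z \<omega>)\<close> the remaining increment.\<close>

lemma (in prob_space) expectation_indep_symmetric:
  fixes f :: "'b \<Rightarrow> real" and h :: "'b \<times> real \<Rightarrow> real"
  assumes indep: "indep_var N Y N' Z" and f[measurable]: "f \<in> borel_measurable N'"
    and sym: "distr M borel (\<lambda>\<omega>. - f (Z \<omega>)) = distr M borel (\<lambda>\<omega>. f (Z \<omega>))"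
    and h[measurable]: "h \<in> borel_measurable (N \<Otimes>\<^sub>M borel)"
  shows "expectation (\<lambda>\<omega>. h (Y \<omega>, f (Z \<omega>))) = expectation (\<lambda>\<omega>. h (Y \<omega>, - f (Z \<omega>)))"
proof -
  have [measurable]: "Y \<in> measurable M N" "Z \<in> measurable M N'"
    by (rule indep_var_rv1[OF indep], rule indep_var_rv2[OF indep])
  have joint: "distr M N Y \<Otimes>\<^sub>M distr M N' Z = distr M (N \<Otimes>\<^sub>M N') (\<lambda>\<omega>. (Y \<omega>, Z \<omega>))"
    using indep unfolding indep_var_distribution_eq by simp
  have *: "distr M (N \<Otimes>\<^sub>M borel) (\<lambda>\<omega>. (Y \<omega>, k (Z \<omega>))) =
      distr M N Y \<Otimes>\<^sub>M distr M borel (\<lambda>\<omega>. k (Z \<omega>))"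
    if [measurable]: "k \<in> borel_measurable N'" for k :: "'b \<Rightarrow> real"
  proof -
    interpret D: prob_space "distr M borel (\<lambda>\<omega>. k (Z \<omega>))"
      by (rule prob_space_distr) simp
    have kZ: "distr (distr M N' Z) borel k = distr M borel (\<lambda>\<omega>. k (Z \<omega>))"
      by (subst distr_distr) (simp_all add: comp_def)
    have "distr M N Y \<Otimes>\<^sub>M distr M borel (\<lambda>\<omega>. k (Z \<omega>)) =
        distr (distr M N Y) N (\<lambda>y. y) \<Otimes>\<^sub>M distr (distr M N' Z) borel k"
      unfolding kZ by (subst distr_distr) (simp_all add: comp_def)
    also have "\<dots> = distr (distr M N Y \<Otimes>\<^sub>M distr M N' Z) (N \<Otimes>\<^sub>M borel) (\<lambda>(y, z). (y, k z))"
      by (rule pair_measure_distr) (simp_all add: kZ D.sigma_finite_measure_axioms)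
    also have "\<dots> = distr M (N \<Otimes>\<^sub>M borel) (\<lambda>\<omega>. (Y \<omega>, k (Z \<omega>)))"
      unfolding joint by (subst distr_distr) (simp_all add: comp_def)
    finally show ?thesis ..
  qed
  have "(\<integral>p. h p \<partial>distr M (N \<Otimes>\<^sub>M borel) (\<lambda>\<omega>. (Y \<omega>, f (Z \<omega>))))
      = (\<integral>p. h p \<partial>distr M (N \<Otimes>\<^sub>M borel) (\<lambda>\<omega>. (Y \<omega>, - f (Z \<omega>))))"
    by (subst (1 2) *) (simp_all only: sym f borel_measurable_uminus)
  then show ?thesis
    by (simp add: integral_distr)
qed

context wiener_process
begin

lemma distr_increment_symmetric:
  assumes "0 \<le> s" "s \<le> t"
  shows "distr P borel (\<lambda>\<omega>. - (W t \<omega> - W s \<omega>)) = distr P borel (\<lambda>\<omega>. W t \<omega> - W s \<omega>)"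
\<comment> \<open>Equality occurs when the first visit falls on the last grid time.\<close>
proof (cases "s = t")
  case False
  then have "s < t" using assms by simp
  have *: "distributed P lborel (\<lambda>\<omega>. W t \<omega> - W s \<omega>) (normal_density 0 (sqrt (t - s)))"
    using assms \<open>s < t\<close> by (intro normal_increments) auto
  have "distributed P lborel (\<lambda>\<omega>. 0 + (-1) * (W t \<omega> - W s \<omega>)) (normal_density (0 + (-1) * 0) (\<bar>-1\<bar> * sqrt (t - s)))"
    using \<open>s < t\<close> by (intro normal_density_affine *) auto
  with * show ?thesis
    by (simp add: distributed_def cong: distr_cong)
qed simp

text \<open>The event \<open>A\<close> depends only on increments before step \<open>j\<close>, so
  it is independent of the symmetric increment from step \<open>j\<close> to step \<open>n\<close>.
  Flipping the sign of that increment reflects the end point in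
  \<open>W (\<tau> j) \<omega>\<close>. This is the strong Markov argument at the first grid
  visit.\<close>

lemma expectation_reflect_increment:
  fixes \<tau> :: "nat \<Rightarrow> real" and g :: "real \<Rightarrow> real" and n j :: nat
  assumes \<tau>: "\<tau> 0 = 0" "\<And>i. i < n \<Longrightarrow> \<tau> i < \<tau> (Suc i)" and "j \<le> n"
    and D[measurable]: "D \<in> sets borel" and g[measurable]: "g \<in> borel_measurable borel"
  defines "A \<equiv> {\<omega> \<in> space P. W (\<tau> j) \<omega> \<in> D \<and> (\<forall>i<j. W (\<tau> i) \<omega> \<notin> D)}"
  shows "expectation (\<lambda>\<omega>. g (W (\<tau> n) \<omega>) * indicator A \<omega>) =
    expectation (\<lambda>\<omega>. g (2 * W (\<tau> j) \<omega> - W (\<tau> n) \<omega>) * indicator A \<omega>)"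
proof -
  have mono: "\<tau> i \<le> \<tau> k" if "i \<le> k" "k \<le> n" for i k
    using that
  proof (induction k rule: dec_induct)
    case (step m)
    then show ?case using \<tau>(2)[of m] by simp
  qed simp
  have nonneg: "0 \<le> \<tau> i" if "i \<le> n" for i
    using mono[of 0 i] that \<tau>(1) by simp
  define I where "I i \<omega> = W (\<tau> (Suc i)) \<omega> - W (\<tau> i) \<omega>" for i \<omega>
  define Y where "Y \<omega> = (\<lambda>i\<in>{..<j}. I i \<omega>)" for \<omega>
  define Z where "Z \<omega> = (\<lambda>i\<in>{j..<n}. I i \<omega>)" for \<omega>
  have indep: "indep_vars (\<lambda>_. borel) I {..<n}"
    unfolding I_def using \<tau> by (intro independent_increments) auto
  have indep_YZ: "indep_var (PiM {..<j} (\<lambda>_. borel)) Y (PiM {j..<n} (\<lambda>_. borel)) Z"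
    unfolding Y_def Z_def using \<open>j \<le> n\<close> by (intro indep_var_restrict[OF indep]) auto
  have X_eq: "(\<Sum>i\<in>{j..<n}. Z \<omega> i) = W (\<tau> n) \<omega> - W (\<tau> j) \<omega>" for \<omega>
  proof -
    have "(\<Sum>i\<in>{j..<n}. Z \<omega> i) = (\<Sum>i\<in>{j..<n}. I i \<omega>)"
      by (intro sum.cong) (auto simp: Z_def)
    also have "\<dots> = W (\<tau> n) \<omega> - W (\<tau> j) \<omega>"
      unfolding I_def using \<open>j \<le> n\<close> by (rule sum_Suc_diff')
    finally show ?thesis .
  qed
  have W_eq: "W (\<tau> i) \<omega> = (\<Sum>k<i. Y \<omega> k)" if "i \<le> j" "\<omega> \<in> space P" for i \<omega>
  proof -
    have "(\<Sum>k<i. Y \<omega> k) = (\<Sum>k<i. I k \<omega>)"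
      using that by (intro sum.cong) (auto simp: Y_def)
    also have "\<dots> = W (\<tau> i) \<omega>"
      using that sum_lessThan_telescope[of "\<lambda>k. W (\<tau> k) \<omega>" i]
      by (simp add: I_def \<tau>(1) start_zero)
    finally show ?thesis ..
  qed
  \<comment> \<open>Since the path starts at 0, its grid values are partial sums of increments; thus
    \<open>E\<close> below is the event \<open>A\<close> read off the vector of past
    increments.\<close>
  define S where "S i y = (\<Sum>k<i. y k)" for i and y :: "nat \<Rightarrow> real"
  have S: "S i \<in> borel_measurable (PiM {..<j} (\<lambda>_. borel))" if "i \<le> j" for i
    unfolding S_def using that by (intro borel_measurable_sum measurable_component_singleton) auto
  define E where "E = {y \<in> space (PiM {..<j} (\<lambda>_. borel)). S j y \<in> D \<and> (\<forall>i\<in>{..<j}. S i y \<notin> D)}"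
  have E[measurable]: "E \<in> sets (PiM {..<j} (\<lambda>_. borel))"
    unfolding E_def
    by (intro sets.sets_Collect sets.sets_Collect_finite_All measurable_sets_Collect[OF S] D) auto
  define h where "h = (\<lambda>(y, x). g (S j y + x) * indicator E y)"
  have h: "h \<in> borel_measurable (PiM {..<j} (\<lambda>_. borel) \<Otimes>\<^sub>M borel)"
    unfolding h_def split_beta
    by (intro borel_measurable_times borel_measurable_add measurable_compose[OF _ g] measurable_snd
        measurable_compose[OF measurable_fst S] measurable_compose[OF measurable_fst borel_measurable_indicator[OF E]]) simp
  have h_Y: "h (Y \<omega>, x) = g (W (\<tau> j) \<omega> + x) * indicator A \<omega>" if "\<omega> \<in> space P" for \<omega> x
  proof -
    have "Y \<omega> \<in> space (PiM {..<j} (\<lambda>_. borel))"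
      by (simp add: Y_def space_PiM)
    moreover have "S i (Y \<omega>) = W (\<tau> i) \<omega>" if "i \<le> j" for i
      using W_eq[OF that \<open>\<omega> \<in> space P\<close>] by (simp add: S_def)
    ultimately show ?thesis
      using that by (auto simp: h_def A_def E_def indicator_def)
  qed
  have sym: "distr P borel (\<lambda>\<omega>. - (\<Sum>i\<in>{j..<n}. Z \<omega> i)) = distr P borel (\<lambda>\<omega>. \<Sum>i\<in>{j..<n}. Z \<omega> i)"
    unfolding X_eq using \<open>j \<le> n\<close> nonneg[of j] mono[of j n] by (intro distr_increment_symmetric) auto
  have "expectation (\<lambda>\<omega>. g (W (\<tau> n) \<omega>) * indicator A \<omega>) = expectation (\<lambda>\<omega>. h (Y \<omega>, \<Sum>i\<in>{j..<n}. Z \<omega> i))"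
    by (intro Bochner_Integration.integral_cong) (simp_all add: h_Y X_eq)
  also have "\<dots> = expectation (\<lambda>\<omega>. h (Y \<omega>, - (\<Sum>i\<in>{j..<n}. Z \<omega> i)))"
    by (rule expectation_indep_symmetric[OF indep_YZ _ sym h]) (auto intro!: borel_measurable_sum)
  also have "\<dots> = expectation (\<lambda>\<omega>. g (2 * W (\<tau> j) \<omega> - W (\<tau> n) \<omega>) * indicator A \<omega>)"
    by (intro Bochner_Integration.integral_cong) (simp_all add: h_Y X_eq)
  finally show ?thesis .
qed

text \<open>Split according to the first grid time at which the path is within \<open>\<delta>\<close> of a barrier \<open>b\<close>. Reversing
  the sign of the later increment moves the end point to within \<open>2 * \<delta>\<close> of its mirror image in \<open>b\<close>, where
  \<open>g\<close> takes the opposite value; the two contributions cancel up to \<open>2 * L * \<delta>\<close>.\<close>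

lemma expectation_near_barrier_grid:
  fixes \<tau> :: "nat \<Rightarrow> real" and g :: "real \<Rightarrow> real" and n :: nat
  assumes \<tau>: "\<tau> 0 = 0" "\<And>i. i < n \<Longrightarrow> \<tau> i < \<tau> (Suc i)"
    and D[measurable]: "D \<in> sets borel" and near: "\<And>x. x \<in> D \<Longrightarrow> \<exists>b\<in>B. \<bar>x - b\<bar> \<le> \<delta>" and "0 \<le> \<delta>"
    and g[measurable]: "g \<in> borel_measurable borel" and bounded: "\<And>x. \<bar>g x\<bar> \<le> K"
    and lipschitz: "\<And>x y. \<bar>g x - g y\<bar> \<le> L * \<bar>x - y\<bar>" and "0 \<le> L"
    and odd: "\<And>b x. b \<in> B \<Longrightarrow> g (2 * b - x) = - g x"
  shows "\<bar>expectation (\<lambda>\<omega>. g (W (\<tau> n) \<omega>) * indicator {\<omega> \<in> space P. \<exists>j\<le>n. W (\<tau> j) \<omega> \<in> D} \<omega>)\<bar> \<le> L * \<delta>"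
proof -
  have nonneg: "0 \<le> \<tau> i" if "i \<le> n" for i
    using that
  proof (induction i)
    case (Suc i)
    then show ?case using \<tau>(2)[of i] by simp
  qed (simp add: \<tau>(1))
  have W: "W (\<tau> i) \<in> borel_measurable P" if "i \<le> n" for i
    using nonneg[OF that] by (rule measurable_W)
  define A where "A j = {\<omega> \<in> space P. W (\<tau> j) \<omega> \<in> D \<and> (\<forall>i\<in>{..<j}. W (\<tau> i) \<omega> \<notin> D)}" for j
  let ?H = "{\<omega> \<in> space P. \<exists>j\<le>n. W (\<tau> j) \<omega> \<in> D}"
  have A: "A j \<in> sets P" if "j \<le> n" for j
    unfolding A_def using that
    by (intro sets.sets_Collect sets.sets_Collect_finite_All measurable_sets_Collect[OF W] D) auto
  have H_eq: "?H = (\<Union>j\<in>{..n}. A j)"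
  proof (intro equalityI subsetI)
    fix \<omega> assume "\<omega> \<in> ?H"
    then obtain j where j: "\<omega> \<in> space P" "j \<le> n" "W (\<tau> j) \<omega> \<in> D" by auto
    define k where "k = (LEAST k. W (\<tau> k) \<omega> \<in> D)"
    have "W (\<tau> k) \<omega> \<in> D" "k \<le> j"
      unfolding k_def using j(3) by (auto intro: LeastI Least_le)
    moreover have "W (\<tau> i) \<omega> \<notin> D" if "i < k" for i
      using not_less_Least that unfolding k_def .
    ultimately show "\<omega> \<in> (\<Union>j\<in>{..n}. A j)"
      using j by (auto simp: A_def intro!: bexI[of _ k])
  qed (auto simp: A_def)
  have disj: "disjoint_family_on A {..n}"
    by (auto simp: disjoint_family_on_def A_def) (metis lessThan_iff linorder_neqE_nat)
  have int: "integrable P (\<lambda>\<omega>. k (W (\<tau> j) \<omega>) (W (\<tau> n) \<omega>) * indicator (A j) \<omega>)"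
    if "j \<le> n" "\<And>x y. \<bar>k x y\<bar> \<le> c" and
      [measurable]: "(\<lambda>(x, y). k x y) \<in> borel_measurable (borel \<Otimes>\<^sub>M borel)"
    for k :: "real \<Rightarrow> real \<Rightarrow> real" and j c
  proof (rule integrable_const_bound[where B=c])
    have [measurable]: "W (\<tau> j) \<in> borel_measurable P" "W (\<tau> n) \<in> borel_measurable P" "A j \<in> sets P"
      using that(1) by (simp_all add: W A)
    show "(\<lambda>\<omega>. k (W (\<tau> j) \<omega>) (W (\<tau> n) \<omega>) * indicator (A j) \<omega>) \<in> borel_measurable P"
      by measurable
    show "AE \<omega> in P. norm (k (W (\<tau> j) \<omega>) (W (\<tau> n) \<omega>) * indicator (A j) \<omega>) \<le> c"
      using that(2) order_trans[OF abs_ge_zero that(2)] by (auto simp: indicator_def)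
  qed
  have step: "\<bar>expectation (\<lambda>\<omega>. g (W (\<tau> n) \<omega>) * indicator (A j) \<omega>)\<bar> \<le> L * \<delta> * prob (A j)"
    if "j \<le> n" for j
  proof -
    let ?G = "\<lambda>\<omega>. g (W (\<tau> n) \<omega>) * indicator (A j) \<omega>"
    let ?G' = "\<lambda>\<omega>. g (2 * W (\<tau> j) \<omega> - W (\<tau> n) \<omega>) * indicator (A j) \<omega>"
    have I: "integrable P ?G" "integrable P ?G'"
      using int[OF that, of "\<lambda>x y. g y" K] int[OF that, of "\<lambda>x y. g (2 * x - y)" K] bounded
      by simp_all
    have "expectation ?G = expectation ?G'"
      using expectation_reflect_increment[OF \<tau> that D g] by (simp add: A_def Ball_def)
    \<comment> \<open>Neither integrand is small by itself, but their sum is small pointwise on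
      \<open>A j\<close>.\<close>
    then have "2 * expectation ?G = expectation (\<lambda>\<omega>. ?G \<omega> + ?G' \<omega>)"
      using Bochner_Integration.integral_add[OF I] by simp
    also have "\<bar>\<dots>\<bar> \<le> expectation (\<lambda>\<omega>. 2 * (L * \<delta>) * indicator (A j) \<omega>)"
    proof -
      have "\<bar>expectation (\<lambda>\<omega>. ?G \<omega> + ?G' \<omega>)\<bar> \<le> expectation (\<lambda>\<omega>. \<bar>?G \<omega> + ?G' \<omega>\<bar>)"
        by (rule integral_abs_bound)
      also have "\<dots> \<le> expectation (\<lambda>\<omega>. 2 * (L * \<delta>) * indicator (A j) \<omega>)"
      proof (rule integral_mono)
        show "integrable P (\<lambda>\<omega>. \<bar>?G \<omega> + ?G' \<omega>\<bar>)"
          using I by auto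
        show "integrable P (\<lambda>\<omega>. 2 * (L * \<delta>) * indicator (A j) \<omega> :: real)"
          using A[OF that] by (intro integrable_mult_right integrable_real_indicator) (auto simp: less_top[symmetric])
        fix \<omega>
        show "\<bar>?G \<omega> + ?G' \<omega>\<bar> \<le> 2 * (L * \<delta>) * indicator (A j) \<omega>"
        proof (cases "\<omega> \<in> A j")
          case True
          then obtain b where b: "b \<in> B" "\<bar>W (\<tau> j) \<omega> - b\<bar> \<le> \<delta>"
            using near unfolding A_def by auto
          let ?x = "W (\<tau> j) \<omega>" and ?y = "W (\<tau> n) \<omega>"
          have "\<bar>g ?y + g (2 * ?x - ?y)\<bar> = \<bar>g ?y - g (2 * b - (2 * ?x - ?y))\<bar>"
            using odd[OF b(1), of "2 * ?x - ?y"] by simp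
          also have "\<dots> \<le> L * \<bar>2 * (?x - b)\<bar>"
            using lipschitz[of ?y "2 * b - (2 * ?x - ?y)"] by (simp add: algebra_simps)
          also have "\<dots> \<le> L * (2 * \<delta>)"
            using b(2) \<open>0 \<le> L\<close> by (intro mult_left_mono) (simp_all add: abs_mult)
          finally show ?thesis
            using True by simp
        qed simp
      qed
      finally show ?thesis .
    qed
    finally show ?thesis
      using A[OF that] by simp
  qed
  have "expectation (\<lambda>\<omega>. g (W (\<tau> n) \<omega>) * indicator ?H \<omega>) =
      expectation (\<lambda>\<omega>. \<Sum>j\<le>n. g (W (\<tau> n) \<omega>) * indicator (A j) \<omega>)"
    unfolding H_eq by (simp add: indicator_UN_disjoint[OF _ disj] sum_distrib_left)
  also have "\<dots> = (\<Sum>j\<le>n. expectation (\<lambda>\<omega>. g (W (\<tau> n) \<omega>) * indicator (A j) \<omega>))"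
    using bounded by (intro Bochner_Integration.integral_sum int[of _ "\<lambda>x y. g y" K]) auto
  also have "\<bar>\<dots>\<bar> \<le> (\<Sum>j\<le>n. L * \<delta> * prob (A j))"
    by (rule order_trans[OF sum_abs]) (intro sum_mono step, simp)
  \<comment> \<open>Disjointness of the first-visit events keeps the total error independent of the
    number of grid points.\<close>
  also have "\<dots> = L * \<delta> * prob (\<Union>j\<in>{..n}. A j)"
    using A disj by (subst finite_measure_finite_Union) (auto simp: sum_distrib_left)
  also have "\<dots> \<le> L * \<delta>"
    using \<open>0 \<le> L\<close> \<open>0 \<le> \<delta>\<close> by (intro mult_right_le_one_le) auto
  finally show ?thesis .
qed

end

section \<open>Hitting events as limits of dyadic grid events\<close>

definition hits :: "'a measure \<Rightarrow> (real \<Rightarrow> 'a \<Rightarrow> real) \<Rightarrow> real \<Rightarrow> real set \<Rightarrow> 'a set"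
  where "hits P W T B = {\<omega> \<in> space P. \<exists>t\<in>{0..T}. W t \<omega> \<in> B}"

context wiener_process
begin

text \<open>Dyadic grids are nested, index \<open>j\<close> reappearing as \<open>2 * j\<close>, so
  the events increase in \<open>n\<close>. They decrease in \<open>m\<close>; \<open>Suc m\<close>
  matters here because \<open>1 / 0 = 0\<close> would make the first tolerance the strictest
  one.\<close>

definition near_grid :: "real \<Rightarrow> real set \<Rightarrow> nat \<Rightarrow> nat \<Rightarrow> 'a set"
  where "near_grid T B m n =
    {\<omega> \<in> space P. \<exists>j\<le>2 ^ n. W (T * real j / 2 ^ n) \<omega> \<in> {x. infdist x B \<le> 1 / real (Suc m)}}"

lemma sets_near_grid:
  assumes "0 < T" shows "near_grid T B m n \<in> sets P"
proof -
  let ?D = "{x. infdist x B \<le> 1 / real (Suc m)}"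
  have D: "?D \<in> sets borel"
    by (intro borel_closed closed_Collect_le continuous_intros)
  have "{\<omega> \<in> space P. W (T * real j / 2 ^ n) \<omega> \<in> ?D} \<in> sets P" for j
  proof -
    have "W (T * real j / 2 ^ n) -` ?D \<inter> space P \<in> sets P"
      using \<open>0 < T\<close> by (intro measurable_sets[OF measurable_W D]) simp
    moreover have "W (T * real j / 2 ^ n) -` ?D \<inter> space P = {\<omega> \<in> space P. W (T * real j / 2 ^ n) \<omega> \<in> ?D}"
      by blast
    ultimately show ?thesis by (rule subst[rotated])
  qed
  then have "{\<omega> \<in> space P. \<exists>j\<in>{..2 ^ n}. W (T * real j / 2 ^ n) \<omega> \<in> ?D} \<in> sets P"
    by (rule sets.sets_Collect_finite_Ex) simp
  then show ?thesis
    unfolding near_grid_def Bex_def atMost_iff .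
qed

lemma incseq_near_grid: "incseq (near_grid T B m)"
proof (rule incseq_SucI, rule subsetI)
  fix n \<omega> assume "\<omega> \<in> near_grid T B m n"
  then obtain j where "\<omega> \<in> space P" "j \<le> 2 ^ n" "infdist (W (T * real j / 2 ^ n) \<omega>) B \<le> 1 / real (Suc m)"
    unfolding near_grid_def by auto
  moreover have eq: "T * real (2 * j) / 2 ^ Suc n = T * real j / 2 ^ n"
    by simp
  ultimately have "infdist (W (T * real (2 * j) / 2 ^ Suc n) \<omega>) B \<le> 1 / real (Suc m)"
    by (simp only:)
  moreover have "2 * j \<le> 2 ^ Suc n"
    using \<open>j \<le> 2 ^ n\<close> by simp
  ultimately show "\<omega> \<in> near_grid T B m (Suc n)"
    unfolding near_grid_def using \<open>\<omega> \<in> space P\<close> by (intro CollectI conjI exI[of _ "2 * j"])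
qed

lemma near_grid_antimono: "m \<le> m' \<Longrightarrow> near_grid T B m' n \<subseteq> near_grid T B m n"
proof -
  assume "m \<le> m'"
  then have "1 / real (Suc m') \<le> 1 / real (Suc m)"
    by (simp add: field_simps)
  then show ?thesis
    unfolding near_grid_def by (auto intro: order_trans)
qed

text \<open>A visit is seen by fine grids because the path is continuous. Conversely, the distance
  to \<open>B\<close> attains its minimum over the compact time interval; that minimum lies below
  every tolerance, hence is 0, and \<open>B\<close> is closed. The identity also makes hitting
  events measurable, although they range over uncountably many times.\<close>

lemma hits_eq_near_grid:
  assumes "0 < T" "closed B" "B \<noteq> {}"
  shows "hits P W T B = (\<Inter>m. \<Union>n. near_grid T B m n)"
proof (intro equalityI subsetI)
  fix \<omega> assume "\<omega> \<in> hits P W T B"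
  then obtain t where \<omega>: "\<omega> \<in> space P" and t: "0 \<le> t" "t \<le> T" "W t \<omega> \<in> B"
    by (auto simp: hits_def)
  have "\<exists>n. \<omega> \<in> near_grid T B m n" for m
  proof -
    have "0 < 1 / real (Suc m)" by simp
    then obtain d where d: "0 < d"
      "\<And>s. 0 \<le> s \<Longrightarrow> dist s t < d \<Longrightarrow> dist (W s \<omega>) (W t \<omega>) < 1 / real (Suc m)"
      using continuous_paths[OF \<omega>, unfolded continuous_on_iff, rule_format, of t "1 / real (Suc m)"] t(1) by auto
    obtain n where n: "T / d < 2 ^ n"
      using real_arch_pow[of 2 "T / d"] by auto
    \<comment> \<open>Rounding down gives a grid time at most one mesh width before
      \<open>t\<close>, and keeps the index within the grid.\<close>
    define j where "j = nat \<lfloor>t * 2 ^ n / T\<rfloor>"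
    have "real j = of_int \<lfloor>t * 2 ^ n / T\<rfloor>"
      using t(1) \<open>0 < T\<close> by (simp add: j_def)
    then have j: "real j \<le> t * 2 ^ n / T" "t * 2 ^ n / T < real j + 1"
      by linarith+
    have "t * 2 ^ n / T \<le> 2 ^ n"
      using t(2) \<open>0 < T\<close> by (simp add: field_simps)
    with j(1) have "real j \<le> 2 ^ n"
      by (rule order_trans)
    then have "j \<le> 2 ^ n"
      by simp
    have "T * real j / 2 ^ n \<le> t" "t < T * real j / 2 ^ n + T / 2 ^ n"
      using j \<open>0 < T\<close> by (simp_all add: field_simps)
    moreover have "T / 2 ^ n < d"
      using n \<open>0 < d\<close> by (simp add: field_simps)
    ultimately have "dist (T * real j / 2 ^ n) t < d"
      by (simp add: dist_real_def)
    then have "dist (W (T * real j / 2 ^ n) \<omega>) (W t \<omega>) < 1 / real (Suc m)"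
      using \<open>0 < T\<close> by (intro d(2)) auto
    then have "infdist (W (T * real j / 2 ^ n) \<omega>) B \<le> 1 / real (Suc m)"
      using infdist_le[OF t(3), of "W (T * real j / 2 ^ n) \<omega>"] by linarith
    then show ?thesis
      using \<omega> \<open>j \<le> 2 ^ n\<close> unfolding near_grid_def by auto
  qed
  then show "\<omega> \<in> (\<Inter>m. \<Union>n. near_grid T B m n)"
    by auto
next
  fix \<omega> assume *: "\<omega> \<in> (\<Inter>m. \<Union>n. near_grid T B m n)"
  then have \<omega>: "\<omega> \<in> space P"
    unfolding near_grid_def by auto
  have "continuous_on {0..T} (\<lambda>t. infdist (W t \<omega>) B)"
    by (intro continuous_on_infdist continuous_on_subset[OF continuous_paths[OF \<omega>]]) auto
  then obtain t where t: "t \<in> {0..T}" "\<And>s. s \<in> {0..T} \<Longrightarrow> infdist (W t \<omega>) B \<le> infdist (W s \<omega>) B"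
    using continuous_attains_inf[of "{0..T}" "\<lambda>t. infdist (W t \<omega>) B"] \<open>0 < T\<close> by auto
  have le: "infdist (W t \<omega>) B \<le> 1 / real (Suc m)" for m
  proof -
    obtain n where "\<omega> \<in> near_grid T B m n"
      using INT_D[OF *, of m] by blast
    then obtain j where "j \<le> 2 ^ n" and j: "infdist (W (T * real j / 2 ^ n) \<omega>) B \<le> 1 / real (Suc m)"
      unfolding near_grid_def by auto
    then have "real j \<le> real (2 ^ n)"
      using of_nat_le_iff by blast
    then have "T * real j / 2 ^ n \<in> {0..T}"
      using \<open>0 < T\<close> by (simp add: field_simps)
    with t(2) j show ?thesis by force
  qed
  have "infdist (W t \<omega>) B \<le> 0"
    using le by (intro LIMSEQ_le_const[OF LIMSEQ_Suc[OF lim_inverse_n']]) auto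
  then have "infdist (W t \<omega>) B = 0"
    using infdist_nonneg[of "W t \<omega>" B] by simp
  then show "\<omega> \<in> hits P W T B"
    using in_closed_iff_infdist_zero[OF assms(2,3)] t(1) \<omega> by (auto simp: hits_def)
qed

lemma sets_hits:
  assumes "0 < T" "closed B" "B \<noteq> {}" shows "hits P W T B \<in> sets P"
  unfolding hits_eq_near_grid[OF assms]
  by (intro sets.countable_INT' sets.countable_UN') (auto intro: sets_near_grid[OF assms(1)])

lemma bounded_expectation_tendsto:
  fixes f :: "nat \<Rightarrow> 'a \<Rightarrow> real"
  assumes "\<And>n. f n \<in> borel_measurable P" "\<And>n \<omega>. \<omega> \<in> space P \<Longrightarrow> \<bar>f n \<omega>\<bar> \<le> K"
    and lim: "\<And>\<omega>. \<omega> \<in> space P \<Longrightarrow> (\<lambda>n. f n \<omega>) \<longlonglongrightarrow> f' \<omega>"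
  shows "(\<lambda>n. expectation (f n)) \<longlonglongrightarrow> expectation f'"
proof (rule integral_dominated_convergence[where w="\<lambda>_. K"])
  show "f' \<in> borel_measurable P"
    using assms(1) lim by (rule borel_measurable_LIMSEQ_metric)
qed (use assms in auto)

text \<open>The grid error depends on the tolerance and not on the mesh. Hence the mesh tends to 0
  first, at fixed \<open>m\<close>, and only then does the tolerance.\<close>

theorem expectation_odd_on_hits:
  fixes g :: "real \<Rightarrow> real"
  assumes T: "0 < T" and B: "closed B" "B \<noteq> {}"
    and g[measurable]: "g \<in> borel_measurable borel" and bounded: "\<And>x. \<bar>g x\<bar> \<le> K"
    and lipschitz: "\<And>x y. \<bar>g x - g y\<bar> \<le> L * \<bar>x - y\<bar>" and "0 \<le> L"
    and odd: "\<And>b x. b \<in> B \<Longrightarrow> g (2 * b - x) = - g x"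
  shows "expectation (\<lambda>\<omega>. g (W T \<omega>) * indicator (hits P W T B) \<omega>) = 0"
proof -
  have [measurable]: "W T \<in> borel_measurable P"
    using T by (intro measurable_W) simp
  have [measurable]: "near_grid T B m n \<in> sets P" for m n
    by (rule sets_near_grid[OF T])
  have [measurable]: "(\<Union>n. near_grid T B m n) \<in> sets P" for m
    by (intro sets.countable_UN') auto
  have ind: "\<bar>g x * indicator A \<omega>\<bar> \<le> K" for x A and \<omega> :: 'a
    using bounded[of x] order_trans[OF abs_ge_zero bounded] by (auto simp: indicator_def)
  have near: "\<bar>expectation (\<lambda>\<omega>. g (W T \<omega>) * indicator (near_grid T B m n) \<omega>)\<bar> \<le> L * (1 / real (Suc m))" for m n
  proof -
    have "\<bar>expectation (\<lambda>\<omega>. g (W (T * real (2 ^ n) / 2 ^ n) \<omega>) * indicator {\<omega> \<in> space P. \<exists>j\<le>2 ^ n.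
        W (T * real j / 2 ^ n) \<omega> \<in> {x. infdist x B \<le> 1 / real (Suc m)}} \<omega>)\<bar> \<le> L * (1 / real (Suc m))"
    proof (rule expectation_near_barrier_grid[where B=B, OF _ _ _ _ _ g bounded lipschitz \<open>0 \<le> L\<close> odd])
      show "{x. infdist x B \<le> 1 / real (Suc m)} \<in> sets borel"
        by (intro borel_closed closed_Collect_le continuous_intros)
      fix x assume "x \<in> {x. infdist x B \<le> 1 / real (Suc m)}"
      moreover obtain b where "b \<in> B" "infdist x B = dist x b"
        using infdist_attains_inf[OF B] by blast
      ultimately show "\<exists>b\<in>B. \<bar>x - b\<bar> \<le> 1 / real (Suc m)"
        by (auto simp: dist_real_def)
    qed (use T in \<open>auto simp: divide_strict_right_mono\<close>)
    then show ?thesis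
      by (simp add: near_grid_def)
  qed
  have "(\<lambda>n. expectation (\<lambda>\<omega>. g (W T \<omega>) * indicator (near_grid T B m n) \<omega>))
      \<longlonglongrightarrow> expectation (\<lambda>\<omega>. g (W T \<omega>) * indicator (\<Union>n. near_grid T B m n) \<omega>)" for m
    by (rule bounded_expectation_tendsto[where K=K])
      (auto intro!: ind tendsto_mult LIMSEQ_indicator_incseq incseq_near_grid)
  note limit = this
  have limit_n: "\<bar>expectation (\<lambda>\<omega>. g (W T \<omega>) * indicator (\<Union>n. near_grid T B m n) \<omega>)\<bar> \<le> L * (1 / real (Suc m))" for m
    by (rule LIMSEQ_le_const2[OF tendsto_rabs[OF limit]]) (intro exI[of _ 0] allI impI near)
  have "decseq (\<lambda>m. \<Union>n. near_grid T B m n)"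
    unfolding decseq_def by (intro allI impI UN_mono near_grid_antimono subset_refl)
  then have "(\<lambda>m. expectation (\<lambda>\<omega>. g (W T \<omega>) * indicator (\<Union>n. near_grid T B m n) \<omega>))
      \<longlonglongrightarrow> expectation (\<lambda>\<omega>. g (W T \<omega>) * indicator (hits P W T B) \<omega>)"
    unfolding hits_eq_near_grid[OF T B]
    by (intro bounded_expectation_tendsto[where K=K]) (auto intro!: ind tendsto_mult LIMSEQ_indicator_decseq)
  then have "(\<lambda>m. \<bar>expectation (\<lambda>\<omega>. g (W T \<omega>) * indicator (\<Union>n. near_grid T B m n) \<omega>)\<bar>)
      \<longlonglongrightarrow> \<bar>expectation (\<lambda>\<omega>. g (W T \<omega>) * indicator (hits P W T B) \<omega>)\<bar>"
    by (rule tendsto_rabs)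
  moreover have "(\<lambda>m. L * (1 / real (Suc m))) \<longlonglongrightarrow> L * 0"
    by (intro tendsto_mult tendsto_const LIMSEQ_Suc[OF lim_inverse_n'])
  ultimately have "\<bar>expectation (\<lambda>\<omega>. g (W T \<omega>) * indicator (hits P W T B) \<omega>)\<bar> \<le> L * 0"
    by (rule LIMSEQ_le) (use limit_n in auto)
  then show ?thesis by simp
qed

end

section \<open>From Lipschitz functions to indicators of closed sets\<close>

lemma infdist_reflect:
  fixes b x :: real
  shows "infdist (2 * b - x) S = infdist x ((\<lambda>a. 2 * b - a) ` S)"
proof -
  have "dist (2 * b - x) a = dist x (2 * b - a)" for a
    by (simp add: dist_real_def)
  then show ?thesis
    by (simp add: infdist_def image_image)
qed

text \<open>Being built from the distance function, it is Lipschitz, and reflecting its argument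
  amounts to reflecting \<open>S\<close>. As \<open>infdist x {} = 0\<close>, the tent over the
  empty set is constantly 1, hence the nonemptiness assumptions below.\<close>

definition tent :: "real set \<Rightarrow> nat \<Rightarrow> real \<Rightarrow> real"
  where "tent S n x = max 0 (1 - real n * infdist x S)"

lemma tent_bounds: "0 \<le> tent S n x" "tent S n x \<le> 1"
  using infdist_nonneg[of x S] by (auto simp: tent_def)

lemma tent_lipschitz: "\<bar>tent S n x - tent S n y\<bar> \<le> real n * \<bar>x - y\<bar>"
proof -
  have "\<bar>tent S n x - tent S n y\<bar> \<le> \<bar>real n * infdist x S - real n * infdist y S\<bar>"
    unfolding tent_def by linarith
  also have "\<dots> = real n * \<bar>infdist x S - infdist y S\<bar>"
    by (simp flip: right_diff_distrib add: abs_mult)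
  also have "\<dots> \<le> real n * \<bar>x - y\<bar>"
    using infdist_triangle_abs[of x S y] by (intro mult_left_mono) (auto simp: dist_real_def)
  finally show ?thesis .
qed

lemma tent_tendsto_indicator:
  assumes "closed S" "S \<noteq> {}"
  shows "(\<lambda>n. tent S n x) \<longlonglongrightarrow> indicator S x"
proof (cases "x \<in> S")
  case True
  then show ?thesis
    by (simp add: tent_def)
next
  case False
  then have "0 < infdist x S"
    using assms infdist_pos_not_in_closed by blast
  then obtain N where N: "1 / infdist x S < real N"
    using reals_Archimedean2 by blast
  have "tent S n x = 0" if "N \<le> n" for n
  proof -
    have "1 / infdist x S < real n"
      using N that by linarith
    then show ?thesis
      using \<open>0 < infdist x S\<close> by (simp add: tent_def field_simps)
  qed
  then have "eventually (\<lambda>n. tent S n x = 0) sequentially"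
    by (auto simp: eventually_sequentially)
  with False show ?thesis
    by (simp add: tendsto_eventually)
qed

text \<open>With two barriers in \<open>B\<close>, a set \<open>S\<close> that is periodic under the composition of the two reflections
  has the same mirror image in both; this replaces the iterated reflections of the method of images.\<close>

theorem (in wiener_process) reflection_principle:
  assumes T: "0 < T" and B: "closed B" "B \<noteq> {}"
    and S: "closed S" "S \<noteq> {}" and S': "closed S'" "S' \<noteq> {}"
    and reflect: "\<And>b. b \<in> B \<Longrightarrow> (\<lambda>x. 2 * b - x) ` S = S'"
  shows "prob {\<omega> \<in> hits P W T B. W T \<omega> \<in> S} = prob {\<omega> \<in> hits P W T B. W T \<omega> \<in> S'}"
proof -
  have W[measurable]: "W T \<in> borel_measurable P"
    using T by (intro measurable_W) simp
  have H[measurable]: "hits P W T B \<in> sets P"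
    using T B by (rule sets_hits)
  have reflect': "(\<lambda>x. 2 * b - x) ` S' = S" if "b \<in> B" for b
    unfolding reflect[OF that, symmetric] by (simp add: image_image)
  \<comment> \<open>Reflection in a point of \<open>B\<close> exchanges \<open>S\<close> and
    \<open>S'\<close>, so the difference of the tents is odd.\<close>
  define g where "g n x = tent S n x - tent S' n x" for n x
  have tent_cont: "continuous_on UNIV (tent A n)" for A n
    unfolding tent_def by (intro continuous_intros)
  have [measurable]: "g n \<in> borel_measurable borel" for n
    unfolding g_def
    by (intro borel_measurable_diff borel_measurable_continuous_onI tent_cont)
  have g_bounded: "\<bar>g n x\<bar> \<le> 1" for n x
    using tent_bounds[of S n x] tent_bounds[of S' n x] by (simp add: g_def abs_le_iff)
  have g_zero: "expectation (\<lambda>\<omega>. g n (W T \<omega>) * indicator (hits P W T B) \<omega>) = 0" for n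
  proof (rule expectation_odd_on_hits[OF T B])
    show "\<bar>g n x\<bar> \<le> 1" for x by (rule g_bounded)
    \<comment> \<open>The constant grows with \<open>n\<close>, which is harmless: the expectation
      is exactly 0 for each \<open>n\<close> before the limit is taken.\<close>
    show "\<bar>g n x - g n y\<bar> \<le> (2 * real n) * \<bar>x - y\<bar>" for x y
      using tent_lipschitz[of S n x y] tent_lipschitz[of S' n x y] unfolding g_def by linarith
    show "g n (2 * b - x) = - g n x" if "b \<in> B" for b x
      by (simp add: g_def tent_def infdist_reflect reflect[OF that] reflect'[OF that])
  qed simp_all
  have "(\<lambda>n. expectation (\<lambda>\<omega>. g n (W T \<omega>) * indicator (hits P W T B) \<omega>)) \<longlonglongrightarrow>
      expectation (\<lambda>\<omega>. (indicator S (W T \<omega>) - indicator S' (W T \<omega>)) * indicator (hits P W T B) \<omega>)"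
  proof (rule bounded_expectation_tendsto[where K=1])
    show "\<bar>g n (W T \<omega>) * indicator (hits P W T B) \<omega>\<bar> \<le> 1" for n \<omega>
      using g_bounded[of n "W T \<omega>"] by (auto simp: indicator_def)
    show "(\<lambda>n. g n (W T \<omega>) * indicator (hits P W T B) \<omega>) \<longlonglongrightarrow>
        (indicator S (W T \<omega>) - indicator S' (W T \<omega>)) * indicator (hits P W T B) \<omega>" for \<omega>
      unfolding g_def by (intro tendsto_mult tendsto_diff tent_tendsto_indicator S S' tendsto_const)
  qed measurable
  then have "expectation (\<lambda>\<omega>. (indicat_real S (W T \<omega>) - indicator S' (W T \<omega>)) * indicator (hits P W T B) \<omega>) = 0"
    unfolding g_zero by (simp add: LIMSEQ_const_iff)
  moreover have "(\<lambda>\<omega>. (indicat_real S (W T \<omega>) - indicator S' (W T \<omega>)) * indicator (hits P W T B) \<omega>) =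
      (\<lambda>\<omega>. indicator {\<omega> \<in> hits P W T B. W T \<omega> \<in> S} \<omega> - indicator {\<omega> \<in> hits P W T B. W T \<omega> \<in> S'} \<omega> :: real)"
    by (auto simp: indicator_def)
  moreover have sets: "{\<omega> \<in> hits P W T B. W T \<omega> \<in> A} \<in> sets P" if "closed A" for A
  proof -
    have "{\<omega> \<in> hits P W T B. W T \<omega> \<in> A} = hits P W T B \<inter> (W T -` A \<inter> space P)"
      using sets.sets_into_space[OF H] by auto
    then show ?thesis
      using measurable_sets[OF W borel_closed[OF that]] by simp
  qed
  ultimately show ?thesis
    using S(1) S'(1) by (simp add: Bochner_Integration.integral_diff less_top[symmetric])
qed

subsection \<open>Running maximum and minimum\<close>

context wiener_process
begin

lemma running_max_attained:
  assumes "0 \<le> T" "\<omega> \<in> space P"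
  shows "\<exists>s\<in>{0..T}. running_max W T \<omega> = W s \<omega> \<and> (\<forall>u\<in>{0..T}. W u \<omega> \<le> W s \<omega>)"
proof -
  have "continuous_on {0..T} (\<lambda>t. W t \<omega>)"
    by (rule continuous_on_subset[OF continuous_paths[OF assms(2)]]) auto
  then obtain s where s: "s \<in> {0..T}" "\<forall>u\<in>{0..T}. W u \<omega> \<le> W s \<omega>"
    using continuous_attains_sup[of "{0..T}" "\<lambda>t. W t \<omega>"] assms(1) by auto
  then have "running_max W T \<omega> = W s \<omega>"
    unfolding running_max_def by (intro cSup_eq_maximum) auto
  with s show ?thesis by blast
qed

lemma running_min_attained:
  assumes "0 \<le> T" "\<omega> \<in> space P"
  shows "\<exists>s\<in>{0..T}. running_min W T \<omega> = W s \<omega> \<and> (\<forall>u\<in>{0..T}. W s \<omega> \<le> W u \<omega>)"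
proof -
  have "continuous_on {0..T} (\<lambda>t. W t \<omega>)"
    by (rule continuous_on_subset[OF continuous_paths[OF assms(2)]]) auto
  then obtain s where s: "s \<in> {0..T}" "\<forall>u\<in>{0..T}. W s \<omega> \<le> W u \<omega>"
    using continuous_attains_inf[of "{0..T}" "\<lambda>t. W t \<omega>"] assms(1) by auto
  then have "running_min W T \<omega> = W s \<omega>"
    unfolding running_min_def by (intro cInf_eq_minimum) auto
  with s show ?thesis by blast
qed

lemma le_running_max_iff:
  assumes "0 \<le> T" "\<omega> \<in> space P"
  shows "y \<le> running_max W T \<omega> \<longleftrightarrow> (\<exists>s\<in>{0..T}. y \<le> W s \<omega>)"
  using running_max_attained[OF assms] by (metis order_trans)

lemma running_min_le_iff:
  assumes "0 \<le> T" "\<omega> \<in> space P"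
  shows "running_min W T \<omega> \<le> z \<longleftrightarrow> (\<exists>s\<in>{0..T}. W s \<omega> \<le> z)"
  using running_min_attained[OF assms] by (metis order_trans)

lemma running_bounds:
  assumes "0 \<le> T" "\<omega> \<in> space P"
  shows "0 \<le> running_max W T \<omega>" "running_min W T \<omega> \<le> 0"
    "W T \<omega> \<le> running_max W T \<omega>" "running_min W T \<omega> \<le> W T \<omega>"
proof -
  have "0 \<in> {0..T}" "T \<in> {0..T}"
    using assms(1) by auto
  then show "0 \<le> running_max W T \<omega>" "running_min W T \<omega> \<le> 0"
    "W T \<omega> \<le> running_max W T \<omega>" "running_min W T \<omega> \<le> W T \<omega>"
    unfolding le_running_max_iff[OF assms] running_min_le_iff[OF assms]
    using start_zero[OF assms(2)] by (metis order_refl)+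
qed

text \<open>The path starts on the near side of the barrier, so by the intermediate value theorem it
  cannot get beyond it without visiting it.\<close>

lemma hits_upper:
  assumes "0 \<le> T" "0 < y"
  shows "hits P W T {y} = {\<omega> \<in> space P. y \<le> running_max W T \<omega>}"
proof -
  have "(\<exists>t\<in>{0..T}. W t \<omega> = y) \<longleftrightarrow> y \<le> running_max W T \<omega>" if \<omega>: "\<omega> \<in> space P" for \<omega>
  proof
    assume "y \<le> running_max W T \<omega>"
    then obtain s where s: "0 \<le> s" "s \<le> T" "y \<le> W s \<omega>"
      using le_running_max_iff[OF assms(1) \<omega>] by auto
    have "continuous_on {0..s} (\<lambda>t. W t \<omega>)"
      by (rule continuous_on_subset[OF continuous_paths[OF \<omega>]]) auto
    then obtain t where "0 \<le> t" "t \<le> s" "W t \<omega> = y"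
      using IVT'[of "\<lambda>t. W t \<omega>" 0 y s] s start_zero[OF \<omega>] assms(2) by auto
    with s show "\<exists>t\<in>{0..T}. W t \<omega> = y"
      by (intro bexI[of _ t]) auto
  qed (use le_running_max_iff[OF assms(1) \<omega>] in auto)
  then show ?thesis
    by (auto simp: hits_def)
qed

lemma hits_lower:
  assumes "0 \<le> T" "z < 0"
  shows "hits P W T {z} = {\<omega> \<in> space P. running_min W T \<omega> \<le> z}"
proof -
  have "(\<exists>t\<in>{0..T}. W t \<omega> = z) \<longleftrightarrow> running_min W T \<omega> \<le> z" if \<omega>: "\<omega> \<in> space P" for \<omega>
  proof
    assume "running_min W T \<omega> \<le> z"
    then obtain s where s: "0 \<le> s" "s \<le> T" "W s \<omega> \<le> z"
      using running_min_le_iff[OF assms(1) \<omega>] by auto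
    have "continuous_on {0..s} (\<lambda>t. W t \<omega>)"
      by (rule continuous_on_subset[OF continuous_paths[OF \<omega>]]) auto
    then obtain t where "0 \<le> t" "t \<le> s" "W t \<omega> = z"
      using IVT2'[of "\<lambda>t. W t \<omega>" s z 0] s start_zero[OF \<omega>] assms(2) by auto
    with s show "\<exists>t\<in>{0..T}. W t \<omega> = z"
      by (intro bexI[of _ t]) auto
  qed (use running_min_le_iff[OF assms(1) \<omega>] in auto)
  then show ?thesis
    by (auto simp: hits_def)
qed

text \<open>Superlevel sets at positive heights are hitting events; at the others they are the whole
  space.\<close>

lemma measurable_running_max: "0 < T \<Longrightarrow> running_max W T \<in> borel_measurable P"
proof (subst borel_measurable_iff_ge, intro allI)
  fix y :: real assume "0 < T"
  show "{\<omega> \<in> space P. y \<le> running_max W T \<omega>} \<in> sets P"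
  proof (cases "0 < y")
    case True
    with \<open>0 < T\<close> show ?thesis
      using sets_hits[of T "{y}"] by (simp add: hits_upper)
  next
    case False
    then have "{\<omega> \<in> space P. y \<le> running_max W T \<omega>} = space P"
      using running_bounds(1)[of T] \<open>0 < T\<close> by force
    then show ?thesis by simp
  qed
qed

lemma measurable_running_min: "0 < T \<Longrightarrow> running_min W T \<in> borel_measurable P"
proof (subst borel_measurable_iff_le, intro allI)
  fix z :: real assume "0 < T"
  show "{\<omega> \<in> space P. running_min W T \<omega> \<le> z} \<in> sets P"
  proof (cases "z < 0")
    case True
    with \<open>0 < T\<close> show ?thesis
      using sets_hits[of T "{z}"] by (simp add: hits_lower)
  next
    case False
    then have "{\<omega> \<in> space P. running_min W T \<omega> \<le> z} = space P"
      using running_bounds(2)[of T] \<open>0 < T\<close> by force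
    then show ?thesis by simp
  qed
qed

lemma measurable_W1[measurable]: "W 1 \<in> borel_measurable P"
  and measurable_M1[measurable]: "running_max W 1 \<in> borel_measurable P"
  and measurable_m1[measurable]: "running_min W 1 \<in> borel_measurable P"
  by (simp_all add: measurable_W measurable_running_max measurable_running_min)

section \<open>Marginal laws at time 1\<close>

lemma distr_W1: "distr P borel (W 1) = std_normal_distribution"
proof -
  have "distributed P lborel (\<lambda>\<omega>. W 1 \<omega> - W 0 \<omega>) std_normal_density"
    using normal_increments[of 0 1] by simp
  then have "distr P lborel (\<lambda>\<omega>. W 1 \<omega> - W 0 \<omega>) = std_normal_distribution"
    by (simp add: distributed_def)
  also have "distr P lborel (\<lambda>\<omega>. W 1 \<omega> - W 0 \<omega>) = distr P borel (W 1)"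
    by (intro distr_cong) (auto simp: start_zero)
  finally show ?thesis .
qed

lemma prob_W1: "A \<in> sets borel \<Longrightarrow> prob {\<omega> \<in> space P. W 1 \<omega> \<in> A} = measure std_normal_distribution A"
  unfolding distr_W1[symmetric] by (subst measure_distr) (auto intro!: arg_cong[where f=prob])

lemma prob_W1_le: "prob {\<omega> \<in> space P. W 1 \<omega> \<le> x} = \<Phi> x"
  using prob_W1[of "{..x}"] by (simp add: Phi_def cdf_def)

lemma prob_W1_ge: "prob {\<omega> \<in> space P. x \<le> W 1 \<omega>} = 1 - \<Phi> x"
  using prob_W1[of "{x..}"] by (simp add: measure_std_normal_atLeast)

text \<open>Paths that reach \<open>y\<close> and end below \<open>x\<close> are matched with paths
  that end above \<open>2 * y - x\<close>. Because \<open>x \<le> y\<close>, the latter end at or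
  above \<open>y\<close> and have certainly reached it, so the hitting condition disappears.\<close>

lemma prob_W1_le_M1_less:
  assumes "x \<le> y" "0 < y"
  shows "prob {\<omega> \<in> space P. W 1 \<omega> \<le> x \<and> running_max W 1 \<omega> < y} = \<Phi> x - \<Phi> (x - 2 * y)"
proof -
  have "(\<lambda>v. 2 * y - v) ` {..x} = {2 * y - x..}"
    by (auto simp: image_iff intro!: bexI[of _ "2 * y - _"])
  then have "prob {\<omega> \<in> hits P W 1 {y}. W 1 \<omega> \<in> {..x}} = prob {\<omega> \<in> hits P W 1 {y}. W 1 \<omega> \<in> {2 * y - x..}}"
    by (intro reflection_principle) auto
  also have "{\<omega> \<in> hits P W 1 {y}. W 1 \<omega> \<in> {2 * y - x..}} = {\<omega> \<in> space P. 2 * y - x \<le> W 1 \<omega>}"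
    using running_bounds(3)[of 1] assms by (force simp: hits_upper)
  also have "prob \<dots> = \<Phi> (x - 2 * y)"
    using Phi_minus[of "2 * y - x"] by (simp add: prob_W1_ge)
  also have "{\<omega> \<in> hits P W 1 {y}. W 1 \<omega> \<in> {..x}} =
      {\<omega> \<in> space P. W 1 \<omega> \<le> x} - {\<omega> \<in> space P. W 1 \<omega> \<le> x \<and> running_max W 1 \<omega> < y}"
    using assms by (auto simp: hits_upper)
  also have "prob \<dots> = prob {\<omega> \<in> space P. W 1 \<omega> \<le> x} - prob {\<omega> \<in> space P. W 1 \<omega> \<le> x \<and> running_max W 1 \<omega> < y}"
    by (rule finite_measure_Diff) (simp, simp, blast)
  finally show ?thesis
    by (simp add: prob_W1_le)
qed

lemma prob_M1_less:
  assumes "0 < y" shows "prob {\<omega> \<in> space P. running_max W 1 \<omega> < y} = 2 * \<Phi> y - 1"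
proof -
  have "{\<omega> \<in> space P. running_max W 1 \<omega> < y} = {\<omega> \<in> space P. W 1 \<omega> \<le> y \<and> running_max W 1 \<omega> < y}"
    using running_bounds(3)[of 1] by force
  then show ?thesis
    using prob_W1_le_M1_less[of y y] assms Phi_minus[of y] by simp
qed

text \<open>The strict event is known, but the law is not yet known to be free of atoms. The upper
  bound therefore lets strict levels \<open>y'\<close> decrease to \<open>y\<close> and uses
  continuity of \<Phi>.\<close>

lemma cdf_M1: "cdf (distr P borel (running_max W 1)) y = max (2 * \<Phi> y - 1) 0"
proof -
  have cdf: "cdf (distr P borel (running_max W 1)) y = prob {\<omega> \<in> space P. running_max W 1 \<omega> \<le> y}"
    unfolding cdf_def by (subst measure_distr) (auto intro!: arg_cong[where f=prob])
  show ?thesis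
  proof (cases "y < 0")
    case True
    then have "{\<omega> \<in> space P. running_max W 1 \<omega> \<le> y} = {}"
      using running_bounds(1)[of 1] by force
    moreover have "\<Phi> y < 1 / 2"
      using True Phi_less_iff[of y 0] by (simp add: Phi_0)
    ultimately show ?thesis
      unfolding cdf by (simp only: measure_empty)
  next
    case False
    have "prob {\<omega> \<in> space P. running_max W 1 \<omega> \<le> y} \<le> 2 * \<Phi> y - 1"
    proof (rule tendsto_lowerbound[OF _ _ trivial_limit_at_right_real])
      show "((\<lambda>y'. 2 * \<Phi> y' - 1) \<longlongrightarrow> 2 * \<Phi> y - 1) (at_right y)"
        using isCont_Phi[of y]
        by (intro tendsto_intros) (simp add: continuous_at filterlim_at_split)
      have "prob {\<omega> \<in> space P. running_max W 1 \<omega> \<le> y} \<le> 2 * \<Phi> y' - 1" if "y < y'" for y'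
      proof -
        have "prob {\<omega> \<in> space P. running_max W 1 \<omega> \<le> y} \<le> prob {\<omega> \<in> space P. running_max W 1 \<omega> < y'}"
          using that by (intro finite_measure_mono) auto
        with prob_M1_less[of y'] that False show ?thesis by simp
      qed
      then show "\<forall>\<^sub>F y' in at_right y. prob {\<omega> \<in> space P. running_max W 1 \<omega> \<le> y} \<le> 2 * \<Phi> y' - 1"
        by (auto simp: eventually_at_right_field intro: exI[of _ "y + 1"])
    qed
    moreover have "2 * \<Phi> y - 1 \<le> prob {\<omega> \<in> space P. running_max W 1 \<omega> \<le> y}"
    \<comment> \<open>The strict formula requires a positive level; at level 0 the bound to be shown
      is just nonnegativity.\<close>
    proof (cases "y = 0")
      case False
      then have "prob {\<omega> \<in> space P. running_max W 1 \<omega> < y} \<le> prob {\<omega> \<in> space P. running_max W 1 \<omega> \<le> y}"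
        by (intro finite_measure_mono) auto
      with prob_M1_less[of y] False \<open>\<not> y < 0\<close> show ?thesis by simp
    qed (simp add: Phi_0)
    moreover have "1 / 2 \<le> \<Phi> y"
      using False Phi_le_iff[of 0 y] by (simp add: Phi_0)
    ultimately show ?thesis
      unfolding cdf by simp
  qed
qed

text \<open>Among the paths that reach \<open>z\<close>, ending above and ending below are equally
  likely, and ending below already forces a visit. The two alternatives overlap only in the null
  event \<open>W 1 \<omega> = z\<close>.\<close>

lemma cdf_m1: "cdf (distr P borel (running_min W 1)) z = min (2 * \<Phi> z) 1"
proof -
  have cdf: "cdf (distr P borel (running_min W 1)) z = prob {\<omega> \<in> space P. running_min W 1 \<omega> \<le> z}"
    unfolding cdf_def by (subst measure_distr) (auto intro!: arg_cong[where f=prob])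
  show ?thesis
  proof (cases "z < 0")
    case False
    then have "{\<omega> \<in> space P. running_min W 1 \<omega> \<le> z} = space P"
      using running_bounds(2)[of 1] by force
    moreover have "1 / 2 \<le> \<Phi> z"
      using False Phi_le_iff[of 0 z] by (simp add: Phi_0)
    ultimately show ?thesis
      unfolding cdf by (simp add: prob_space)
  next
    case True
    let ?H = "hits P W 1 {z}"
    have H: "?H = {\<omega> \<in> space P. running_min W 1 \<omega> \<le> z}"
      using True by (simp add: hits_lower)
    have le: "{\<omega> \<in> ?H. W 1 \<omega> \<in> {..z}} = {\<omega> \<in> space P. W 1 \<omega> \<le> z}"
      using running_bounds(4)[of 1] unfolding H by force
    have "(\<lambda>v. 2 * z - v) ` {z..} = {..z}"
      by (auto simp: image_iff intro!: bexI[of _ "2 * z - _"])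
    then have ge: "prob {\<omega> \<in> ?H. W 1 \<omega> \<in> {z..}} = \<Phi> z"
      unfolding prob_W1_le[symmetric] le[symmetric] by (intro reflection_principle) auto
    have "AE \<omega> in P. W 1 \<omega> \<noteq> z"
      using AE_std_normal_neq[of z] unfolding distr_W1[symmetric] by (subst (asm) AE_distr_iff) auto
    then have "prob ?H = prob ({\<omega> \<in> ?H. W 1 \<omega> \<in> {z..}} \<union> {\<omega> \<in> ?H. W 1 \<omega> \<in> {..z}})"
      by (intro arg_cong[where f=prob]) auto
    also have "\<dots> = prob {\<omega> \<in> ?H. W 1 \<omega> \<in> {z..}} + prob {\<omega> \<in> ?H. W 1 \<omega> \<in> {..z}}"
    proof (rule measure_Un_AE)
      show "AE \<omega> in P. \<omega> \<notin> {\<omega> \<in> ?H. W 1 \<omega> \<in> {z..}} \<or> \<omega> \<notin> {\<omega> \<in> ?H. W 1 \<omega> \<in> {..z}}"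
        using \<open>AE \<omega> in P. W 1 \<omega> \<noteq> z\<close> by eventually_elim auto
    qed (auto simp: H fmeasurable_eq_sets)
    also have "\<dots> = 2 * \<Phi> z"
      unfolding ge unfolding le prob_W1_le by simp
    finally show ?thesis
      unfolding cdf H using True Phi_less_iff[of z 0] by (simp add: Phi_0)
  qed
qed

lemma cdf_W1: "cdf (distr P borel (W 1)) = \<Phi>"
  by (simp add: distr_W1 Phi_def)

lemma isCont_cdf_M1: "isCont (cdf (distr P borel (running_max W 1))) y"
  unfolding cdf_M1[abs_def] by (intro continuous_intros isCont_Phi)

text \<open>Bridges the weak inequality of the distribution function and the strict one in the
  complement of a hitting event.\<close>

lemma AE_M1_neq: "AE \<omega> in P. running_max W 1 \<omega> \<noteq> y"
proof -
  interpret D: real_distribution "distr P borel (running_max W 1)" by simp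
  have "measure (distr P borel (running_max W 1)) {y} = 0"
    using D.isCont_cdf isCont_cdf_M1 by blast
  then have "AE x in distr P borel (running_max W 1). x \<notin> {y}"
    by (subst (asm) D.prob_eq_0) auto
  then show ?thesis
    by (subst (asm) AE_distr_iff) auto
qed

end

subsection \<open>Periodic families of intervals\<close>

definition translates :: "real \<Rightarrow> real \<Rightarrow> real \<Rightarrow> real set"
  where "translates s a b = {v. \<exists>k::int. v - of_int k * s \<in> {a..b}}"

text \<open>An infinite union of closed sets need not be closed; this one is the sum of a compact
  interval and a closed lattice.\<close>

lemma closed_translates: "closed (translates s a b)"
proof -
  have "closed ((\<lambda>x. s *\<^sub>R x) ` (\<int> :: real set))"
    by (intro closed_scaling closed_Ints)
  then have "closed (\<Union>x\<in>{a..b}. \<Union>y\<in>(\<lambda>x. s *\<^sub>R x) ` \<int>. {x + y})"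
    by (intro compact_closed_sums compact_Icc)
  also have "(\<Union>x\<in>{a..b}. \<Union>y\<in>(\<lambda>x. s *\<^sub>R x) ` \<int>. {x + y}) = translates s a b"
  proof (intro equalityI subsetI)
    fix v assume "v \<in> translates s a b"
    then obtain k :: int where "v - of_int k * s \<in> {a..b}"
      unfolding translates_def by blast
    then show "v \<in> (\<Union>x\<in>{a..b}. \<Union>y\<in>(\<lambda>x. s *\<^sub>R x) ` \<int>. {x + y})"
      by (intro UN_I[of "v - of_int k * s"] UN_I[of "s * of_int k"]) auto
  next
    fix v assume "v \<in> (\<Union>x\<in>{a..b}. \<Union>y\<in>(\<lambda>x. s *\<^sub>R x) ` \<int>. {x + y})"
    then obtain x k where "x \<in> {a..b}" "v = x + s *\<^sub>R of_int k"
      unfolding Ints_def by blast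
    then show "v \<in> translates s a b"
      unfolding translates_def by (intro CollectI exI[of _ k]) (simp add: algebra_simps)
  qed
  finally show ?thesis .
qed

text \<open>The integer \<open>m\<close> counts periods: reflections in different barriers give the
  same family when the reflected intervals differ by a multiple of \<open>s\<close>.\<close>

lemma translates_reflect:
  assumes "b' = 2 * \<beta> - a + of_int m * s" "a' = 2 * \<beta> - b + of_int m * s"
  shows "(\<lambda>v. 2 * \<beta> - v) ` translates s a b = translates s a' b'"
proof (intro equalityI subsetI)
  fix u assume "u \<in> (\<lambda>v. 2 * \<beta> - v) ` translates s a b"
  then obtain v and k :: int where "u = 2 * \<beta> - v" "v - of_int k * s \<in> {a..b}"
    unfolding translates_def by auto
  then show "u \<in> translates s a' b'"
    unfolding translates_def using assms by (intro CollectI exI[of _ "- k - m"]) (simp add: algebra_simps)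
next
  fix u assume "u \<in> translates s a' b'"
  then obtain k :: int where "u - of_int k * s \<in> {a'..b'}"
    unfolding translates_def by auto
  then have "2 * \<beta> - u \<in> translates s a b"
    unfolding translates_def using assms by (intro CollectI exI[of _ "- k - m"]) (simp add: algebra_simps)
  then show "u \<in> (\<lambda>v. 2 * \<beta> - v) ` translates s a b"
    by (rule rev_image_eqI) simp
qed

lemma disjoint_translates:
  fixes a b s :: real and j k :: int
  assumes "b - a < s" "v - of_int j * s \<in> {a..b}" "v - of_int k * s \<in> {a..b}"
  shows "j = k"
proof -
  have "a \<le> b" using assms(2) by auto
  then have "0 < s" using assms(1) by linarith
  have "\<bar>(of_int j - of_int k) * s\<bar> < 1 * s"
    using assms by (simp add: algebra_simps abs_le_iff abs_less_iff)
  then have "\<bar>of_int j - of_int k\<bar> < (1 :: real)"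
    using \<open>0 < s\<close> by (simp add: abs_mult)
  then show ?thesis by linarith
qed

text \<open>The numbers \<open>m\<close> and \<sigma> select an arithmetic progression of indices,
  which serves both halves of the integers.\<close>

lemma Phi_translates_sums:
  fixes m :: int and \<sigma> :: int
  assumes "a \<le> b" "b - a < s" "\<sigma> \<noteq> 0"
  shows "(\<lambda>k. \<Phi> (b + of_int (m + \<sigma> * int k) * s) - \<Phi> (a + of_int (m + \<sigma> * int k) * s)) sums
    measure std_normal_distribution (\<Union>k. {v. v - of_int (m + \<sigma> * int k) * s \<in> {a..b}})"
proof -
  define A where "A k = {v. v - of_int (m + \<sigma> * int k) * s \<in> {a..b}}" for k
  have A: "A k = {a + of_int (m + \<sigma> * int k) * s .. b + of_int (m + \<sigma> * int k) * s}" for k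
    unfolding A_def by auto
  have "disjoint_family A"
    unfolding disjoint_family_on_def
  proof (intro ballI impI)
    fix j k :: nat assume "j \<noteq> k"
    then have "m + \<sigma> * int j \<noteq> m + \<sigma> * int k"
      using assms(3) by simp
    then show "A j \<inter> A k = {}"
      unfolding A_def using disjoint_translates[OF assms(2)] by blast
  qed
  moreover have "A k \<in> sets std_normal_distribution" for k
    by (simp add: A)
  ultimately have "(\<lambda>k. measure std_normal_distribution (A k)) sums measure std_normal_distribution (\<Union>k. A k)"
    by (intro std_normal.finite_measure_UNION) blast+
  moreover have "measure std_normal_distribution (A k) =
      \<Phi> (b + of_int (m + \<sigma> * int k) * s) - \<Phi> (a + of_int (m + \<sigma> * int k) * s)" for k
    unfolding A using assms(1) by (intro measure_std_normal_Icc) simp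
  ultimately show ?thesis
    unfolding A_def by simp
qed

lemma measure_translates:
  assumes "a \<le> b" "b - a < s"
  shows "measure std_normal_distribution (translates s a b) =
    (\<Sum>k. \<Phi> (b - real k * s) - \<Phi> (a - real k * s)) +
    (\<Sum>k. \<Phi> (b + s + real k * s) - \<Phi> (a + s + real k * s))"
    (is "_ = suminf ?f + suminf ?g")
  and "summable (\<lambda>k. \<Phi> (b - real k * s) - \<Phi> (a - real k * s))"
  and "summable (\<lambda>k. \<Phi> (b + s + real k * s) - \<Phi> (a + s + real k * s))"
proof -
  define I where "I k = {v. v - of_int k * s \<in> {a..b}}" for k :: int
  have I: "I k \<in> sets borel" for k
  proof -
    have "I k = {a + of_int k * s .. b + of_int k * s}"
      unfolding I_def by auto
    then show ?thesis by simp
  qed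
  have f: "?f sums measure std_normal_distribution (\<Union>k. I (- int k))"
    using Phi_translates_sums[OF assms, of "-1" 0] by (simp add: I_def)
  have g: "?g sums measure std_normal_distribution (\<Union>k. I (1 + int k))"
    using Phi_translates_sums[OF assms, of 1 1] by (simp add: I_def algebra_simps)
  have "translates s a b = (\<Union>k. I k)"
    by (auto simp: translates_def I_def)
  \<comment> \<open>Index 0 belongs to the first half, so the second starts at 1; this is the extra
    \<open>s\<close> in the second series.\<close>
  also have "\<dots> = (\<Union>k. I (- int k)) \<union> (\<Union>k. I (1 + int k))"
  proof (intro equalityI subsetI)
    fix v assume "v \<in> (\<Union>k. I k)"
    then obtain k where k: "v \<in> I k" by blast
    show "v \<in> (\<Union>k. I (- int k)) \<union> (\<Union>k. I (1 + int k))"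
    proof (cases "k \<le> 0")
      case True
      with k have "v \<in> I (- int (nat (- k)))" by simp
      then show ?thesis by blast
    next
      case False
      with k have "v \<in> I (1 + int (nat (k - 1)))" by simp
      then show ?thesis by blast
    qed
  qed blast
  also have "measure std_normal_distribution \<dots> =
      measure std_normal_distribution (\<Union>k. I (- int k)) + measure std_normal_distribution (\<Union>k. I (1 + int k))"
  proof (rule std_normal.finite_measure_Union)
    show "(\<Union>k. I (- int k)) \<inter> (\<Union>k. I (1 + int k)) = {}"
    proof (intro equals0I)
      fix v assume "v \<in> (\<Union>k. I (- int k)) \<inter> (\<Union>k. I (1 + int k))"
      then obtain j k where "v \<in> I (- int j)" "v \<in> I (1 + int k)" by blast
      then have "- int j = 1 + int k"
        unfolding I_def using disjoint_translates[OF assms(2)] by blast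
      then show False by simp
    qed
  qed (auto intro!: sets.countable_UN' I)
  finally show "measure std_normal_distribution (translates s a b) = suminf ?f + suminf ?g"
    using sums_unique[OF f] sums_unique[OF g] by simp
  show "summable ?f" "summable ?g"
    using f g by (auto simp: sums_iff)
qed

text \<open>The terms are normal masses of the intervals from \<open>q - r - k * s\<close> to
  \<open>q - k * s\<close>, which are disjoint because \<open>r < s\<close>.\<close>

lemma Psi_sums:
  assumes "0 \<le> r" "r < s"
  shows "(\<lambda>k. \<Phi> (q - real k * s) - \<Phi> (q - r - real k * s)) sums \<Psi> q r s"
  unfolding Psi_def using assms by (intro summable_sums measure_translates(2)) auto

text \<open>Used to absorb the one-barrier term \<open>\<Phi> x - \<Phi> (x - r)\<close> into the
  series.\<close>

lemma Psi_Suc: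
  assumes "0 \<le> r" "r < s"
  shows "\<Psi> q r s = \<Phi> q - \<Phi> (q - r) + \<Psi> (q - s) r s"
proof -
  have "(\<lambda>k. \<Phi> (q - s - real k * s) - \<Phi> (q - s - r - real k * s)) sums \<Psi> (q - s) r s"
    by (rule Psi_sums[OF assms])
  then have "(\<lambda>k. \<Phi> (q - real (Suc k) * s) - \<Phi> (q - r - real (Suc k) * s)) sums \<Psi> (q - s) r s"
    by (simp add: algebra_simps)
  then have "(\<lambda>k. \<Phi> (q - real k * s) - \<Phi> (q - r - real k * s)) sums
      (\<Psi> (q - s) r s + (\<Phi> (q - real 0 * s) - \<Phi> (q - r - real 0 * s)))"
    by (rule sums_Suc)
  then show ?thesis
    using sums_unique2[OF Psi_sums[OF assms]] by simp
qed

text \<open>Each family gives two one-sided series. The terms of \<Psi> appear only when the lower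
  half of one family is paired with the upper half of the other: \<open>a\<close> with
  \<open>d\<close>, and \<open>b\<close> with \<open>c\<close>.\<close>

lemma measure_translates_diff:
  fixes x y z :: real
  assumes "z < x" "x \<le> y" "0 < y" "z < 0"
  defines "r \<equiv> 2 * y" and "s \<equiv> 2 * (y - z)"
  shows "measure std_normal_distribution (translates s z x)
      - measure std_normal_distribution (translates s (2 * z - x) z) =
    \<Psi> x r s - \<Psi> z r s + \<Psi> (- x - s + r) r s - \<Psi> z r s"
proof -
  have rs: "0 \<le> r" "r < s" and len: "z \<le> x" "x - z < s" "2 * z - x \<le> z" "z - (2 * z - x) < s"
    using assms(1-4) by (auto simp: r_def s_def)
  have reflect: "\<Phi> p - \<Phi> q = \<Phi> (- q) - \<Phi> (- p)" for p q
    by (simp add: Phi_minus)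
  define a b c d where "a k = \<Phi> (x - real k * s) - \<Phi> (z - real k * s)"
    and "b k = \<Phi> (x + s + real k * s) - \<Phi> (z + s + real k * s)"
    and "c k = \<Phi> (z - real k * s) - \<Phi> (2 * z - x - real k * s)"
    and "d k = \<Phi> (z + s + real k * s) - \<Phi> (2 * z - x + s + real k * s)" for k
  have summable: "summable a" "summable b" "summable c" "summable d"
    unfolding a_def b_def c_def d_def
    using measure_translates(2,3)[OF len(1,2)] measure_translates(2,3)[OF len(3,4)] by simp_all
  note \<psi> = Psi_sums[OF rs]
  have "(\<lambda>k. a k - d k) sums (\<Psi> x r s - \<Psi> z r s)"
  proof -
    \<comment> \<open>Reflection at 0 carries this upper-tail interval to the translate of
      \<open>[z, x]\<close> by \<open>- r - k * s\<close>, which supplies the subtracted terms of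
      \<Psi>.\<close>
    have d: "d k = \<Phi> (x - r - real k * s) - \<Phi> (z - r - real k * s)" for k
      unfolding d_def by (subst reflect) (simp add: r_def s_def algebra_simps)
    have "a k - d k = (\<Phi> (x - real k * s) - \<Phi> (x - r - real k * s)) -
        (\<Phi> (z - real k * s) - \<Phi> (z - r - real k * s))" for k
      unfolding a_def d by simp
    then show ?thesis
      using sums_diff[OF \<psi>[of x] \<psi>[of z]] by (simp only:)
  qed
  moreover have "(\<lambda>k. b k - c k) sums (\<Psi> (- x - s + r) r s - \<Psi> z r s)"
  proof -
    have b: "b k = \<Phi> (z - r - real k * s) - \<Phi> (- x - s - real k * s)" for k
      unfolding b_def by (subst reflect) (simp add: r_def s_def algebra_simps)
    have c: "c k = \<Phi> (z - real k * s) - \<Phi> (- x - s + r - real k * s)" for k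
      unfolding c_def by (simp add: r_def s_def algebra_simps)
    have "b k - c k = (\<Phi> (- x - s + r - real k * s) - \<Phi> (- x - s + r - r - real k * s)) -
        (\<Phi> (z - real k * s) - \<Phi> (z - r - real k * s))" for k
      unfolding b c by simp
    then show ?thesis
      using sums_diff[OF \<psi>[of "- x - s + r"] \<psi>[of z]] by (simp only:)
  qed
  ultimately have "suminf a - suminf d + (suminf b - suminf c) =
      \<Psi> x r s - \<Psi> z r s + (\<Psi> (- x - s + r) r s - \<Psi> z r s)"
    using summable by (simp add: suminf_diff sums_iff)
  then show ?thesis
    unfolding measure_translates(1)[OF len(1,2)] measure_translates(1)[OF len(3,4)]
    unfolding a_def b_def c_def d_def by simp
qed

subsection \<open>The joint distribution function\<close>

text \<open>The joint distribution function at time 1. If \<open>0 \<le> z\<close> or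
  \<open>x \<le> z\<close>, the bound on the minimum is automatic. Capping \<open>x\<close> at
  \<open>y\<close> is legitimate because the end point never exceeds the maximum.\<close>

definition wiener_cdf3 :: "real \<Rightarrow> real \<Rightarrow> real \<Rightarrow> real"
  where "wiener_cdf3 x y z =
    (let x' = min x y; r = 2 * y; s = 2 * (y - z)
     in if y \<le> 0 then 0
        else if 0 \<le> z \<or> x \<le> z then \<Phi> x' - \<Phi> (x' - r)
        else 2 * \<Psi> z r s - \<Psi> (x' - s) r s - \<Psi> (- x' - s + r) r s)"

context wiener_process
begin

lemma prob_W1_le_confined:
  assumes "z < x" "x \<le> y" "0 < y" "z < 0"
  defines "r \<equiv> 2 * y" and "s \<equiv> 2 * (y - z)"
  shows "prob {\<omega> \<in> space P. W 1 \<omega> \<le> x \<and> running_max W 1 \<omega> < y \<and> z < running_min W 1 \<omega>} =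
    \<Psi> x r s - \<Psi> z r s + \<Psi> (- x - s + r) r s - \<Psi> z r s"
proof -
  let ?H = "hits P W 1 {y, z}" and ?S = "translates s z x" and ?S' = "translates s (2 * z - x) z"
  have "?H = hits P W 1 {y} \<union> hits P W 1 {z}"
    unfolding hits_def by blast
  then have H: "?H = {\<omega> \<in> space P. y \<le> running_max W 1 \<omega> \<or> running_min W 1 \<omega> \<le> z}"
    unfolding hits_upper[OF zero_le_one assms(3)] hits_lower[OF zero_le_one assms(4)]
    by (simp only: Collect_conj_eq Collect_disj_eq Int_Un_distrib)
  have S: "(\<lambda>v. 2 * b - v) ` ?S = ?S'" if "b \<in> {y, z}" for b
  proof -
    have "(\<lambda>v. 2 * y - v) ` ?S = ?S'"
      \<comment> \<open>Reflecting \<open>[z, x]\<close> in \<open>y\<close> gives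
        \<open>[2 * z - x, z]\<close> shifted up by one period.\<close>
      by (rule translates_reflect[where m="-1"]) (simp_all add: s_def)
    moreover have "(\<lambda>v. 2 * z - v) ` ?S = ?S'"
      by (rule translates_reflect[where m=0]) simp_all
    ultimately show ?thesis
      using that by auto
  qed
  have nonempty: "?S \<noteq> {}" "?S' \<noteq> {}"
  proof -
    have "z - of_int 0 * s \<in> {z..x}" "z - of_int 0 * s \<in> {2 * z - x..z}"
      using assms(1) by auto
    then show "?S \<noteq> {}" "?S' \<noteq> {}"
      unfolding translates_def by blast+
  qed
  have "prob {\<omega> \<in> ?H. W 1 \<omega> \<in> ?S} = prob {\<omega> \<in> ?H. W 1 \<omega> \<in> ?S'}"
    by (intro reflection_principle closed_translates nonempty S) auto
  \<comment> \<open>The hitting parts for \<open>?S\<close> and \<open>?S'\<close> agree, so they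
    cancel in the difference of the two normal masses.\<close>
  moreover have split: "measure std_normal_distribution A =
      prob {\<omega> \<in> ?H. W 1 \<omega> \<in> A} + prob {\<omega> \<in> space P - ?H. W 1 \<omega> \<in> A}" if "closed A" for A
  proof -
    have A[measurable]: "A \<in> sets borel"
      using that by simp
    have "measure std_normal_distribution A = prob {\<omega> \<in> space P. W 1 \<omega> \<in> A}"
      by (rule prob_W1[symmetric]) simp
    also have "{\<omega> \<in> space P. W 1 \<omega> \<in> A} = {\<omega> \<in> ?H. W 1 \<omega> \<in> A} \<union> {\<omega> \<in> space P - ?H. W 1 \<omega> \<in> A}"
      by (auto simp: H)
    also have "prob \<dots> = prob {\<omega> \<in> ?H. W 1 \<omega> \<in> A} + prob {\<omega> \<in> space P - ?H. W 1 \<omega> \<in> A}"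
    proof (rule finite_measure_Union)
      have "{\<omega> \<in> ?H. W 1 \<omega> \<in> A} = {\<omega> \<in> space P. (y \<le> running_max W 1 \<omega> \<or> running_min W 1 \<omega> \<le> z) \<and> W 1 \<omega> \<in> A}"
        by (auto simp: H)
      then show "{\<omega> \<in> ?H. W 1 \<omega> \<in> A} \<in> sets P" by simp
      have "{\<omega> \<in> space P - ?H. W 1 \<omega> \<in> A} = {\<omega> \<in> space P. \<not> (y \<le> running_max W 1 \<omega> \<or> running_min W 1 \<omega> \<le> z) \<and> W 1 \<omega> \<in> A}"
        by (auto simp: H)
      then show "{\<omega> \<in> space P - ?H. W 1 \<omega> \<in> A} \<in> sets P" by simp
    qed auto
    finally show ?thesis .
  qed
  ultimately have "prob {\<omega> \<in> space P - ?H. W 1 \<omega> \<in> ?S} - prob {\<omega> \<in> space P - ?H. W 1 \<omega> \<in> ?S'} =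
      measure std_normal_distribution ?S - measure std_normal_distribution ?S'"
    using split[OF closed_translates, of s z x] split[OF closed_translates, of s "2 * z - x" z] by simp
  moreover have conf: "z < W 1 \<omega> \<and> W 1 \<omega> < y" if "\<omega> \<in> space P - ?H" for \<omega>
    using that running_bounds(3,4)[of 1 \<omega>] by (auto simp: H)
  \<comment> \<open>The points \<open>v\<close> and \<open>v - k * s\<close> both lie between the
    barriers, which are only \<open>s / 2\<close> apart, so \<open>k = 0\<close>.\<close>
  have in_S: "v \<in> ?S \<longleftrightarrow> v \<le> x" if "z < v" "v < y" for v
  proof
    assume "v \<in> ?S"
    then obtain k :: int where k: "v - of_int k * s \<in> {z..x}"
      unfolding translates_def by blast
    have "v - of_int 0 * s \<in> {z..y}" "v - of_int k * s \<in> {z..y}"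
      using k that assms(2) by auto
    then have "0 = k"
      by (rule disjoint_translates[rotated]) (use assms(3,4) in \<open>simp add: s_def\<close>)
    with k show "v \<le> x" by auto
  next
    assume "v \<le> x"
    with that have "v - of_int 0 * s \<in> {z..x}" by simp
    then show "v \<in> ?S"
      unfolding translates_def by blast
  qed
  \<comment> \<open>Translates with \<open>k \<le> 0\<close> lie at or below \<open>z\<close>; those
    with \<open>k \<ge> 1\<close> start at \<open>2 * y - x\<close> or higher, hence not below
    \<open>y\<close>.\<close>
  have not_in_S': "v \<notin> ?S'" if "z < v" "v < y" for v
  proof
    assume "v \<in> ?S'"
    then obtain k :: int where k: "v - of_int k * s \<in> {2 * z - x..z}"
      unfolding translates_def by blast
    have "0 < s"
      using assms(3,4) by (simp add: s_def)
    consider "k \<le> 0" | "1 \<le> k" by linarith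
    then show False
    proof cases
      case 1
      then have "of_int k * s \<le> 0 * s"
        using \<open>0 < s\<close> by (intro mult_right_mono) auto
      with k that show False by simp
    next
      case 2
      then have "1 * s \<le> of_int k * s"
        using \<open>0 < s\<close> by (intro mult_right_mono) auto
      moreover have "2 * z - x \<le> v - of_int k * s" "s = 2 * y - 2 * z"
        using k by (auto simp: s_def)
      ultimately show False
        using that assms(2) by linarith
    qed
  qed
  have "{\<omega> \<in> space P - ?H. W 1 \<omega> \<in> ?S} =
      {\<omega> \<in> space P. W 1 \<omega> \<le> x \<and> running_max W 1 \<omega> < y \<and> z < running_min W 1 \<omega>}"
    using conf in_S by (auto simp: H)
  moreover have "{\<omega> \<in> space P - ?H. W 1 \<omega> \<in> ?S'} = {}"
    using conf not_in_S' by blast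
  moreover have "measure std_normal_distribution ?S - measure std_normal_distribution ?S' =
      \<Psi> x r s - \<Psi> z r s + \<Psi> (- x - s + r) r s - \<Psi> z r s"
    unfolding r_def s_def by (rule measure_translates_diff[OF assms(1-4)])
  ultimately show ?thesis
    by (simp only: measure_empty diff_zero)
qed

lemma joint_cdf3_wiener1:
  "joint_cdf3 P (W 1) (running_max W 1) (running_min W 1) x y z = wiener_cdf3 x y z"
proof (cases "0 < y")
  case False
  have "joint_cdf3 P (W 1) (running_max W 1) (running_min W 1) x y z \<le>
      prob {\<omega> \<in> space P. running_max W 1 \<omega> \<le> y}"
    unfolding joint_cdf3_def by (intro finite_measure_mono) auto
  also have "\<dots> = cdf (distr P borel (running_max W 1)) y"
    unfolding cdf_def by (subst measure_distr) (auto intro!: arg_cong[where f=prob])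
  also have "\<dots> = 0"
    using False Phi_le_iff[of y 0] by (simp add: cdf_M1 Phi_0)
  finally show ?thesis
    using False by (simp add: wiener_cdf3_def Let_def joint_cdf3_def measure_le_0_iff)
next
  case True
  define x' where "x' = min x y"
  have "joint_cdf3 P (W 1) (running_max W 1) (running_min W 1) x y z =
      prob {\<omega> \<in> space P. W 1 \<omega> \<le> x' \<and> running_max W 1 \<omega> < y \<and> running_min W 1 \<omega> \<le> z}"
    unfolding joint_cdf3_def
  proof (rule measure_eq_AE)
    show "AE \<omega> in P. \<omega> \<in> {\<omega> \<in> space P. W 1 \<omega> \<le> x \<and> running_max W 1 \<omega> \<le> y \<and> running_min W 1 \<omega> \<le> z} \<longleftrightarrow>
        \<omega> \<in> {\<omega> \<in> space P. W 1 \<omega> \<le> x' \<and> running_max W 1 \<omega> < y \<and> running_min W 1 \<omega> \<le> z}"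
      using AE_M1_neq[of y] AE_space
    proof eventually_elim
      case (elim \<omega>)
      then show ?case
        using running_bounds(3)[of 1 \<omega>] by (auto simp: x'_def)
    qed
  qed simp_all
  also have "\<dots> = wiener_cdf3 x y z"
  proof (cases "0 \<le> z \<or> x \<le> z")
    case one_sided: True
    have "running_min W 1 \<omega> \<le> z" if "\<omega> \<in> space P" "W 1 \<omega> \<le> x'" for \<omega>
      using running_bounds(2,4)[of 1 \<omega>] that one_sided by (auto simp: x'_def)
    then have "{\<omega> \<in> space P. W 1 \<omega> \<le> x' \<and> running_max W 1 \<omega> < y \<and> running_min W 1 \<omega> \<le> z} =
        {\<omega> \<in> space P. W 1 \<omega> \<le> x' \<and> running_max W 1 \<omega> < y}"
      by blast
    then show ?thesis
      using prob_W1_le_M1_less[of x' y] True one_sided by (simp add: wiener_cdf3_def Let_def x'_def)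
  next
    case False
    define r s where "r = 2 * y" and "s = 2 * (y - z)"
    have rs: "0 \<le> r" "r < s"
      using True False by (auto simp: r_def s_def)
    let ?A = "{\<omega> \<in> space P. W 1 \<omega> \<le> x' \<and> running_max W 1 \<omega> < y}"
    let ?B = "{\<omega> \<in> space P. W 1 \<omega> \<le> x' \<and> running_max W 1 \<omega> < y \<and> z < running_min W 1 \<omega>}"
    have "{\<omega> \<in> space P. W 1 \<omega> \<le> x' \<and> running_max W 1 \<omega> < y \<and> running_min W 1 \<omega> \<le> z} = ?A - ?B"
      by auto
    moreover have "prob (?A - ?B) = prob ?A - prob ?B"
    proof (rule finite_measure_Diff)
      show "?B \<subseteq> ?A" by (intro Collect_mono) simp
    qed simp_all
    moreover have "prob ?A = \<Phi> x' - \<Phi> (x' - r)"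
      unfolding r_def using True by (intro prob_W1_le_M1_less) (simp_all add: x'_def)
    moreover have "prob ?B = \<Psi> x' r s - \<Psi> z r s + \<Psi> (- x' - s + r) r s - \<Psi> z r s"
      unfolding r_def s_def
    proof (rule prob_W1_le_confined)
      show "z < x'" "x' \<le> y" "0 < y" "z < 0"
        using True False by (auto simp: x'_def)
    qed
    \<comment> \<open>The confined probability contains \<open>\<Psi> x' r s\<close>; the first term
      of that series is exactly the one-barrier probability, which leaves the tail
      \<open>\<Psi> (x' - s) r s\<close>.\<close>
    ultimately have "prob {\<omega> \<in> space P. W 1 \<omega> \<le> x' \<and> running_max W 1 \<omega> < y \<and> running_min W 1 \<omega> \<le> z} =
        2 * \<Psi> z r s - \<Psi> (x' - s) r s - \<Psi> (- x' - s + r) r s"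
      using Psi_Suc[OF rs, of x'] by simp
    also have "\<dots> = wiener_cdf3 x y z"
      using True False unfolding wiener_cdf3_def Let_def x'_def r_def s_def by simp
    finally show ?thesis .
  qed
  finally show ?thesis .
qed

section \<open>Brownian scaling\<close>

lemma wiener_process_scale:
  assumes "0 < c"
  shows "wiener_process P (\<lambda>t \<omega>. W (c * t) \<omega> / sqrt c)"
proof
  fix t :: real assume "0 \<le> t"
  then show "(\<lambda>\<omega>. W (c * t) \<omega> / sqrt c) \<in> borel_measurable P"
    using assms by (intro borel_measurable_divide measurable_W) auto
next
  fix \<omega> assume "\<omega> \<in> space P"
  then show "W (c * 0) \<omega> / sqrt c = 0"
    by (simp add: start_zero)
  show "continuous_on {0..} (\<lambda>t. W (c * t) \<omega> / sqrt c)"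
    using assms
    by (intro continuous_intros continuous_on_compose2[OF continuous_paths[OF \<open>\<omega> \<in> space P\<close>]]) auto
next
  fix \<tau> :: "nat \<Rightarrow> real" and n
  assume \<tau>: "0 \<le> \<tau> 0" "\<And>i. i < n \<Longrightarrow> \<tau> i < \<tau> (Suc i)"
  have "indep_vars (\<lambda>_. borel) (\<lambda>i \<omega>. W (c * \<tau> (Suc i)) \<omega> - W (c * \<tau> i) \<omega>) {..<n}"
    using \<tau> assms by (intro independent_increments) auto
  then have "indep_vars (\<lambda>_. borel) (\<lambda>i \<omega>. (W (c * \<tau> (Suc i)) \<omega> - W (c * \<tau> i) \<omega>) / sqrt c) {..<n}"
    by (rule indep_vars_compose2) simp
  then show "indep_vars (\<lambda>_. borel) (\<lambda>i \<omega>. W (c * \<tau> (Suc i)) \<omega> / sqrt c - W (c * \<tau> i) \<omega> / sqrt c) {..<n}"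
    by (simp add: diff_divide_distrib)
next
  fix s t :: real assume st: "0 \<le> s" "s < t"
  have "distributed P lborel (\<lambda>\<omega>. W (c * t) \<omega> - W (c * s) \<omega>) (normal_density 0 (sqrt (c * t - c * s)))"
    using st assms by (intro normal_increments) auto
  then have "distributed P lborel (\<lambda>\<omega>. 0 + (1 / sqrt c) * (W (c * t) \<omega> - W (c * s) \<omega>))
      (normal_density (0 + (1 / sqrt c) * 0) (\<bar>1 / sqrt c\<bar> * sqrt (c * t - c * s)))"
    using st assms by (intro normal_density_affine) auto
  moreover have "\<bar>1 / sqrt c\<bar> * sqrt (c * t - c * s) = sqrt (t - s)"
    using assms by (simp add: real_sqrt_mult flip: right_diff_distrib)
  ultimately show "distributed P lborel (\<lambda>\<omega>. W (c * t) \<omega> / sqrt c - W (c * s) \<omega> / sqrt c) (normal_density 0 (sqrt (t - s)))"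
    by (simp add: diff_divide_distrib)
qed

lemma running_max_scale:
  assumes "0 < c" "\<omega> \<in> space P"
  shows "running_max (\<lambda>t \<omega>. W (c * t) \<omega> / sqrt c) 1 \<omega> = running_max W c \<omega> / sqrt c"
proof -
  interpret S: wiener_process P "\<lambda>t \<omega>. W (c * t) \<omega> / sqrt c"
    by (rule wiener_process_scale[OF assms(1)])
  have "y \<le> running_max (\<lambda>t \<omega>. W (c * t) \<omega> / sqrt c) 1 \<omega> \<longleftrightarrow> y \<le> running_max W c \<omega> / sqrt c" for y
  proof -
    have "y \<le> running_max (\<lambda>t \<omega>. W (c * t) \<omega> / sqrt c) 1 \<omega> \<longleftrightarrow> (\<exists>s\<in>{0..1}. y * sqrt c \<le> W (c * s) \<omega>)"
      using assms by (simp add: S.le_running_max_iff pos_le_divide_eq)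
    also have "\<dots> \<longleftrightarrow> (\<exists>u\<in>(\<lambda>s. c * s) ` {0..1}. y * sqrt c \<le> W u \<omega>)"
      by blast
    also have "(\<lambda>s. c * s) ` {0..1} = {0..c}"
      using assms(1) by simp
    finally show ?thesis
      using assms by (simp add: le_running_max_iff pos_le_divide_eq)
  qed
  then show ?thesis
    by (meson order_antisym order_refl)
qed

lemma running_min_scale:
  assumes "0 < c" "\<omega> \<in> space P"
  shows "running_min (\<lambda>t \<omega>. W (c * t) \<omega> / sqrt c) 1 \<omega> = running_min W c \<omega> / sqrt c"
proof -
  interpret S: wiener_process P "\<lambda>t \<omega>. W (c * t) \<omega> / sqrt c"
    by (rule wiener_process_scale[OF assms(1)])
  have "running_min (\<lambda>t \<omega>. W (c * t) \<omega> / sqrt c) 1 \<omega> \<le> y \<longleftrightarrow> running_min W c \<omega> / sqrt c \<le> y" for y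
  proof -
    have "running_min (\<lambda>t \<omega>. W (c * t) \<omega> / sqrt c) 1 \<omega> \<le> y \<longleftrightarrow> (\<exists>s\<in>{0..1}. W (c * s) \<omega> \<le> y * sqrt c)"
      using assms by (simp add: S.running_min_le_iff pos_divide_le_eq)
    also have "\<dots> \<longleftrightarrow> (\<exists>u\<in>(\<lambda>s. c * s) ` {0..1}. W u \<omega> \<le> y * sqrt c)"
      by blast
    also have "(\<lambda>s. c * s) ` {0..1} = {0..c}"
      using assms(1) by simp
    finally show ?thesis
      using assms by (simp add: running_min_le_iff pos_divide_le_eq)
  qed
  then show ?thesis
    by (meson order_antisym order_refl)
qed

lemma joint_cdf3_wiener:
  assumes "0 < t"
  shows "joint_cdf3 P (W t) (running_max W t) (running_min W t) x y z =
    wiener_cdf3 (x / sqrt t) (y / sqrt t) (z / sqrt t)"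
proof -
  interpret S: wiener_process P "\<lambda>s \<omega>. W (t * s) \<omega> / sqrt t"
    by (rule wiener_process_scale[OF assms])
  show ?thesis
    unfolding S.joint_cdf3_wiener1[symmetric] joint_cdf3_def using assms
    by (intro arg_cong[where f=prob] Collect_cong conj_cong)
      (simp_all add: running_max_scale running_min_scale divide_le_cancel)
qed

lemma cdf_scale:
  fixes X Y :: "'a \<Rightarrow> real"
  assumes "0 < c" "X \<in> borel_measurable P" "Y \<in> borel_measurable P"
    and "\<And>\<omega>. \<omega> \<in> space P \<Longrightarrow> Y \<omega> = X \<omega> / c"
  shows "cdf (distr P borel X) x = cdf (distr P borel Y) (x / c)"
  unfolding cdf_def using assms
  by (simp add: measure_distr) (auto simp: divide_le_cancel intro!: arg_cong[where f=prob])

lemma cdf_wiener: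
  assumes "0 < t"
  shows "cdf (distr P borel (W t)) x = \<Phi> (x / sqrt t)"
    and "cdf (distr P borel (running_max W t)) x = max (2 * \<Phi> (x / sqrt t) - 1) 0"
    and "cdf (distr P borel (running_min W t)) x = min (2 * \<Phi> (x / sqrt t)) 1"
proof -
  interpret S: wiener_process P "\<lambda>s \<omega>. W (t * s) \<omega> / sqrt t"
    by (rule wiener_process_scale[OF assms])
  show "cdf (distr P borel (W t)) x = \<Phi> (x / sqrt t)"
    unfolding S.cdf_W1[symmetric]
    using assms S.measurable_W1 by (intro cdf_scale measurable_W) auto
  show "cdf (distr P borel (running_max W t)) x = max (2 * \<Phi> (x / sqrt t) - 1) 0"
    unfolding S.cdf_M1[symmetric]
    using assms S.measurable_M1 by (intro cdf_scale measurable_running_max running_max_scale) auto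
  show "cdf (distr P borel (running_min W t)) x = min (2 * \<Phi> (x / sqrt t)) 1"
    unfolding S.cdf_m1[symmetric]
    using assms S.measurable_m1 by (intro cdf_scale measurable_running_min running_min_scale) auto
qed

lemma ex1_copula_wiener:
  assumes "0 < t"
  shows "\<exists>!C. is_copula_of P (W t) (running_max W t) (running_min W t) C"
proof (rule sklar_continuous_margins)
  show "isCont (cdf (distr P borel (W t))) x" "isCont (cdf (distr P borel (running_max W t))) x"
    "isCont (cdf (distr P borel (running_min W t))) x" for x
    unfolding cdf_wiener[OF assms, abs_def] using assms
    by (intro continuous_intros isCont_o2[OF _ isCont_Phi]; simp)+
qed (use assms in \<open>simp_all add: measurable_W measurable_running_max measurable_running_min\<close>)

text \<open>The right-hand side is free of \<open>t\<close>: dividing all arguments by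
  \<open>sqrt t\<close> merely permutes the real triples. This is why one copula serves all
  times.\<close>

lemma is_copula_of_wiener_iff:
  assumes "0 < t"
  shows "is_copula_of P (W t) (running_max W t) (running_min W t) C \<longleftrightarrow> copula C \<and>
    (\<forall>x y z. wiener_cdf3 x y z = C (\<Phi> x, max (2 * \<Phi> y - 1) 0, min (2 * \<Phi> z) 1))"
proof -
  have scale: "(\<forall>x y z. Q (x / sqrt t) (y / sqrt t) (z / sqrt t)) \<longleftrightarrow> (\<forall>x y z. Q x y z)"
    for Q :: "real \<Rightarrow> real \<Rightarrow> real \<Rightarrow> bool"
  proof (intro iffI allI)
    fix x y z assume "\<forall>x y z. Q (x / sqrt t) (y / sqrt t) (z / sqrt t)"
    from this[rule_format, of "x * sqrt t" "y * sqrt t" "z * sqrt t"] assms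
    show "Q x y z" by simp
  qed blast
  show ?thesis
    unfolding is_copula_of_def joint_cdf3_wiener[OF assms] cdf_wiener[OF assms]
    using scale[of "\<lambda>x y z. wiener_cdf3 x y z = C (\<Phi> x, max (2 * \<Phi> y - 1) 0, min (2 * \<Phi> z) 1)"]
    by (rule arg_cong)
qed

end

subsection \<open>The copula\<close>

text \<open>The arguments invert the three margins, and monotonicity of \<Phi> turns the case
  conditions into \<open>x \<le> z\<close> and \<open>x \<le> y\<close>. In the last case
  \<open>x\<close> is capped at \<open>y\<close>, and both \<open>y - s\<close> and
  \<open>- y - s + r\<close> equal \<open>2 * z - y\<close>, so two series merge into one.\<close>

lemma wiener_cdf3_Phi_inv:
  assumes u: "u \<in> {0<..<1}" and v: "v \<in> {0<..<1}" and w: "w \<in> {0<..<1}"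
  defines "r \<equiv> 2 * \<Phi>\<^sup>-\<^sup>1 ((1 + v) / 2)"
    and "s \<equiv> 2 * (\<Phi>\<^sup>-\<^sup>1 ((1 + v) / 2) - \<Phi>\<^sup>-\<^sup>1 (w / 2))"
  shows "wiener_cdf3 (\<Phi>\<^sup>-\<^sup>1 u) (\<Phi>\<^sup>-\<^sup>1 ((1 + v) / 2)) (\<Phi>\<^sup>-\<^sup>1 (w / 2)) =
    (if 2 * u \<le> w then u - \<Phi> (\<Phi>\<^sup>-\<^sup>1 u - r)
     else if 2 * u \<le> 1 + v then
       2 * \<Psi> (\<Phi>\<^sup>-\<^sup>1 (w / 2)) r s - \<Psi> (\<Phi>\<^sup>-\<^sup>1 u - s) r s - \<Psi> (- \<Phi>\<^sup>-\<^sup>1 u - s + r) r s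
     else
       2 * \<Psi> (\<Phi>\<^sup>-\<^sup>1 (w / 2)) r s
         - 2 * \<Psi> (2 * \<Phi>\<^sup>-\<^sup>1 (w / 2) - \<Phi>\<^sup>-\<^sup>1 ((1 + v) / 2)) r s)"
proof -
  define x y z where "x = \<Phi>\<^sup>-\<^sup>1 u" and "y = \<Phi>\<^sup>-\<^sup>1 ((1 + v) / 2)" and "z = \<Phi>\<^sup>-\<^sup>1 (w / 2)"
  have xyz: "\<Phi> x = u" "\<Phi> y = (1 + v) / 2" "\<Phi> z = w / 2"
    unfolding x_def y_def z_def
    using u v w Phi_Phi_inv[of u] Phi_Phi_inv[of "(1 + v) / 2"] Phi_Phi_inv[of "w / 2"] by simp_all
  have "0 < y" "z < 0"
    using Phi_less_iff[of 0 y] Phi_less_iff[of z 0] v w by (auto simp: Phi_0 xyz)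
  moreover have "2 * u \<le> w \<longleftrightarrow> x \<le> z"
    using Phi_le_iff[of x z] by (auto simp: xyz)
  moreover have "2 * u \<le> 1 + v \<longleftrightarrow> x \<le> y"
    using Phi_le_iff[of x y] by (auto simp: xyz)
  ultimately show ?thesis
    unfolding r_def s_def x_def[symmetric] y_def[symmetric] z_def[symmetric]
    by (auto simp: wiener_cdf3_def Let_def min_def xyz algebra_simps)
qed

theorem theorem2p1:
  fixes P :: "'a measure" and W :: "real \<Rightarrow> 'a \<Rightarrow> real"
  assumes "wiener_process P W"
  shows "\<exists>C.
    (\<forall>t>0. \<forall>C'. is_copula_of P (W t) (running_max W t) (running_min W t) C' \<longleftrightarrow> C' = C) \<and>
    (\<forall>t>0. \<forall>x y z.
      joint_cdf3 P (W t) (running_max W t) (running_min W t) x y z =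
        C (\<Phi> (x / sqrt t), max (2 * \<Phi> (y / sqrt t) - 1) 0, min (2 * \<Phi> (z / sqrt t)) 1)) \<and>
    (\<forall>u\<in>{0<..<1}. \<forall>v\<in>{0<..<1}. \<forall>w\<in>{0<..<1}.
      let r = 2 * \<Phi>\<^sup>-\<^sup>1 ((1 + v) / 2);
          s = 2 * (\<Phi>\<^sup>-\<^sup>1 ((1 + v) / 2) - \<Phi>\<^sup>-\<^sup>1 (w / 2))
      in C (u, v, w) =
        (if 2 * u \<le> w then u - \<Phi> (\<Phi>\<^sup>-\<^sup>1 u - r)
         else if 2 * u \<le> 1 + v then
           2 * \<Psi> (\<Phi>\<^sup>-\<^sup>1 (w / 2)) r s - \<Psi> (\<Phi>\<^sup>-\<^sup>1 u - s) r s - \<Psi> (- \<Phi>\<^sup>-\<^sup>1 u - s + r) r s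
         else
           2 * \<Psi> (\<Phi>\<^sup>-\<^sup>1 (w / 2)) r s
             - 2 * \<Psi> (2 * \<Phi>\<^sup>-\<^sup>1 (w / 2) - \<Phi>\<^sup>-\<^sup>1 ((1 + v) / 2)) r s))"
proof -
  interpret wiener_process P W by fact
  obtain C where C: "is_copula_of P (W 1) (running_max W 1) (running_min W 1) C"
    using ex1_copula_wiener[of 1] by auto
  have C_t: "is_copula_of P (W t) (running_max W t) (running_min W t) C" if "0 < t" for t
    using C is_copula_of_wiener_iff[of 1 C] is_copula_of_wiener_iff[OF that, of C] by simp
  have C_cdf: "wiener_cdf3 x y z = C (\<Phi> x, max (2 * \<Phi> y - 1) 0, min (2 * \<Phi> z) 1)" for x y z
    using C is_copula_of_wiener_iff[of 1 C] by simp
  show ?thesis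
  proof (intro exI[of _ C] conjI allI impI ballI)
    fix t :: real and C' assume "0 < t"
    then show "is_copula_of P (W t) (running_max W t) (running_min W t) C' \<longleftrightarrow> C' = C"
      using ex1_copula_wiener[of t] C_t[of t] by auto
  next
    fix t x y z :: real assume "0 < t"
    then show "joint_cdf3 P (W t) (running_max W t) (running_min W t) x y z =
        C (\<Phi> (x / sqrt t), max (2 * \<Phi> (y / sqrt t) - 1) 0, min (2 * \<Phi> (z / sqrt t)) 1)"
      by (simp only: joint_cdf3_wiener C_cdf)
  next
    fix u v w :: real assume uvw: "u \<in> {0<..<1}" "v \<in> {0<..<1}" "w \<in> {0<..<1}"
    \<comment> \<open>In the open cube the truncations by \<open>max\<close> and \<open>min\<close>
      are inactive, so the chosen arguments have margins exactly \<open>u\<close>, \<open>v\<close>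
      and \<open>w\<close>.\<close>
    have "C (u, v, w) = wiener_cdf3 (\<Phi>\<^sup>-\<^sup>1 u) (\<Phi>\<^sup>-\<^sup>1 ((1 + v) / 2)) (\<Phi>\<^sup>-\<^sup>1 (w / 2))"
      using uvw by (simp add: C_cdf Phi_Phi_inv add_divide_distrib)
    then show "let r = 2 * \<Phi>\<^sup>-\<^sup>1 ((1 + v) / 2);
          s = 2 * (\<Phi>\<^sup>-\<^sup>1 ((1 + v) / 2) - \<Phi>\<^sup>-\<^sup>1 (w / 2))
      in C (u, v, w) =
        (if 2 * u \<le> w then u - \<Phi> (\<Phi>\<^sup>-\<^sup>1 u - r)
         else if 2 * u \<le> 1 + v then
           2 * \<Psi> (\<Phi>\<^sup>-\<^sup>1 (w / 2)) r s - \<Psi> (\<Phi>\<^sup>-\<^sup>1 u - s) r s - \<Psi> (- \<Phi>\<^sup>-\<^sup>1 u - s + r) r s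
         else
           2 * \<Psi> (\<Phi>\<^sup>-\<^sup>1 (w / 2)) r s
             - 2 * \<Psi> (2 * \<Phi>\<^sup>-\<^sup>1 (w / 2) - \<Phi>\<^sup>-\<^sup>1 ((1 + v) / 2)) r s)"
      unfolding Let_def using wiener_cdf3_Phi_inv[OF uvw] by simp
  qed
qed

end
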